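(* Let $(\mu_\alpha,c_\alpha)$ be a net where each $\mu_\alpha$ is a Borel probability measure on $\mathbb{R}$, $c_\alpha>0$ and $(c_\alpha)$ converges to $0$, and let $\overline{L}$ be the associated generalized log-moment generating function. Let $\lambda\ge 0$ and $\varepsilon>0$. Assume that $\overline{L}_{\mid ]\lambda,\lambda+\varepsilon[}$ is differentiable and that $\sup\{\overline{L}'(t):t\in\,]\lambda,\lambda+\varepsilon[\}$ is not a maximum; when $\lambda=0$ and $\overline{L}_r'(0^+)=-\infty$, assume further that $\overline{L}$ is right continuous at zero. a) For each $z\in[\overline{L}_r'(\lambda^+),\overline{L}_l'(\lambda+\varepsilon)[$ there exists $t_z\in[\lambda,\lambda+\varepsilon[$ with $\overline{L}_r'(t_z^+)=z$; and for each such $t_z$, for each net $(x_{\alpha,z})$ in $[-\infty,+\infty]$ converging to $z$, and for each net $(y_{\alpha,z})$ in $[-\infty,+\infty]$ with $\liminf_\alpha y_{\alpha,z}>z$ (nets indexed by the same directed set), we have $$\limsup_\alpha c_\alpha\log\mu_\alpha([x_{\alpha,z},y_{\alpha,z}])=\limsup_\alpha c_\alpha\log\mu_\alpha(]x_{\alpha,z},y_{\alpha,z}[)=\overline{L}(t_z^+)-t_z z,$$ and this common value equals $$\begin{cases}-\overline{L}^*(z)=\inf_{t>0}\{\overline{L}(t)-tz\} & \text{if } z\neq-\infty,\\[2pt] -\lim_\alpha\overline{L}^*(x_{\alpha,z})=0 & \text{if } z=-\infty\ \text{(i.e. } \lambda=0 \text{ and } z=\overline{L}_r'(0^+)=-\infty).\end{cases}$$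 Furthermore, put $\tilde{t_z}=\sup\{t>t_z:\overline{L}_{\mid ]t_z,t]}\text{ is affine}\}$. If there is a sequence $(t_{z,i})$ in $]\tilde{t_z},+\infty[$ converging to $\tilde{t_z}$ such that $L(t_{z,i})$ exists for every $i$, then the upper limits $\limsup_\alpha c_\alpha\log\mu_\alpha([x_{\alpha,z},y_{\alpha,z}])$ and $\limsup_\alpha c_\alpha\log\mu_\alpha(]x_{\alpha,z},y_{\alpha,z}[)$ are limits. b) The map $[\overline{L}_r'(\lambda^+),\overline{L}_l'(\lambda+\varepsilon)[\,\ni z\mapsto\overline{L}(t_z^+)-t_z z$ is $]-\infty,0]$-valued, strictly decreasing, continuous, unbounded below if and only if $\overline{L}_l'(\lambda+\varepsilon)=+\infty$, and vanishes at $\overline{L}_r'(\lambda^+)$ if and only if either $\lambda>0$ and $\overline{L}$ is differentiable at $\lambda$ and linear on $[0,\lambda]$, or $\lambda=0$ and $\overline{L}$ is right continuous at zero. Its restriction to $]\overline{L}_r'(\lambda^+),\overline{L}_l'(\lambda+\varepsilon)[$ is strictly concave, and this restriction is furthermore differentiable when $\overline{L}_{\mid ]\tilde{\lambda},\lambda+\varepsilon[}$ is strictly convex, where $\tilde{\lambda}=\sup\{t>\lambda:\overline{L}_{\mid ]\lambda,t]}\text{ is affine}\}$.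
   Context: For $t\in\mathbb{R}$, $\overline{L}(t)=\limsup_\alpha c_\alpha\log\int_{\mathbb{R}}e^{c_\alpha^{-1}tx}\,\mu_\alpha(dx)\in[-\infty,+\infty]$; it is a convex function with $\overline{L}(0)=0$. "$L(t)$ exists" means that this upper limit is a limit. $\overline{L}^*(x)=\sup_{t\in\mathbb{R}}\{tx-\overline{L}(t)\}$ is the Legendre-Fenchel transform. For $t\ge 0$, $\overline{L}'_r(t)$ is the right derivative of $\overline{L}$ at $t$, where one puts $\overline{L}'_r(t)=+\infty$ if $\overline{L}(s)=+\infty$ for all $s>t$, and $\overline{L}'_r(t)=-\infty$ if $\overline{L}(s)=-\infty$ for some $s>t$. For $t\ge0$, $\overline{L}'_r(t^+)=\lim_{s\to t,\,s>t}\overline{L}'_r(s)$ and $\overline{L}(t^+)=\lim_{s\to t,\,s>t}\overline{L}(s)$ in $[-\infty,+\infty]$. Differentiability of $\overline{L}$ on $]\lambda,\lambda+\varepsilon[$ includes that $\overline{L}$ is real-valued there. $\overline{L}'_l(\lambda+\varepsilon)$ denotes the left derivative at $\lambda+\varepsilon$, understood as $\lim_{t\to\lambda+\varepsilon,\,t<\lambda+\varepsilon}\overline{L}'(t)\in\,]-\infty,+\infty]$. Conventions: $]a,b[$ denotes the open interval, $]a,b]$ and $[a,b[$ the half-open intervals; these are intervals in $[-\infty,+\infty]$ with its usual topology; $\log 0=-\infty$; each $\mu_\alpha$ is regarded as a Borel measure on $[-\infty,+\infty]$, so that intervals may have infinite endpoints; when $z=-\infty$ (so $t_z=0$), $t_z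 z=0\cdot(-\infty)=0$; when $\overline{L}'_r(0^+)=-\infty$, $\overline{L}^*$ is extended to $-\infty$ by continuity, by putting $\overline{L}^*(-\infty)=-\overline{L}(0^+)$. In the definitions of $\tilde{t_z}$ and $\tilde\lambda$, the supremum is taken to be $t_z$, respectively $\lambda$, when the set is empty. In part b), $t_z$ is any point as in part a) (the value $\overline{L}(t_z^+)-t_z z$ does not depend on its choice). *)

theory Defs
  imports "HOL-Probability.Probability"
begin

definition directed_set :: "'i set \<Rightarrow> ('i \<Rightarrow> 'i \<Rightarrow> bool) \<Rightarrow> bool" where
  "directed_set D le \<longleftrightarrow>
     D \<noteq> {} \<and>
     (\<forall>i\<in>D. le i i) \<and>
     (\<forall>i\<in>D. \<forall>j\<in>D. \<forall>k\<in>D. le i j \<longrightarrow> le j k \<longrightarrow> le i k) \<and>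
     (\<forall>i\<in>D. \<forall>j\<in>D. \<exists>k\<in>D. le i k \<and> le j k)"

(* The filter generated by the tails of D: convergence and upper/lower limits along it are
   those of nets indexed by D.  Values of a net outside D are irrelevant. *)
definition net_filter :: "'i set \<Rightarrow> ('i \<Rightarrow> 'i \<Rightarrow> bool) \<Rightarrow> 'i filter" where
  "net_filter D le = (INF i\<in>D. principal {j \<in> D. le i j})"

definition elog :: "ennreal \<Rightarrow> ereal" where
  "elog x = (if x = 0 then -\<infinity> else if x = \<infinity> then \<infinity> else ereal (ln (enn2real x)))"

definition scaled_log_mgf :: "('i \<Rightarrow> real measure) \<Rightarrow> ('i \<Rightarrow> real) \<Rightarrow> real \<Rightarrow> 'i \<Rightarrow> ereal" where
  "scaled_log_mgf \<mu> c t i = ereal (c i) * elog (\<integral>\<^sup>+ x. ennreal (exp (inverse (c i) * t * x)) \<partial>\<mu> i)"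

definition upper_log_mgf ::
    "'i filter \<Rightarrow> ('i \<Rightarrow> real measure) \<Rightarrow> ('i \<Rightarrow> real) \<Rightarrow> real \<Rightarrow> ereal" where
  "upper_log_mgf F \<mu> c t = Limsup F (scaled_log_mgf \<mu> c t)"

definition log_mgf_exists ::
    "'i filter \<Rightarrow> ('i \<Rightarrow> real measure) \<Rightarrow> ('i \<Rightarrow> real) \<Rightarrow> real \<Rightarrow> bool" where
  "log_mgf_exists F \<mu> c t \<longleftrightarrow> (scaled_log_mgf \<mu> c t \<longlongrightarrow> upper_log_mgf F \<mu> c t) F"

(* A set A of extended reals is measured by the image of the Borel measure \<mu> i on the real line
   under the embedding into [-\<infinity>, \<infinity>]. *)
definition scaled_log_prob ::
    "('i \<Rightarrow> real measure) \<Rightarrow> ('i \<Rightarrow> real) \<Rightarrow> ('i \<Rightarrow> ereal set) \<Rightarrow> 'i \<Rightarrow> ereal" where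
  "scaled_log_prob \<mu> c A i = ereal (c i) * elog (emeasure (distr (\<mu> i) borel ereal) (A i))"

definition right_lim :: "(real \<Rightarrow> ereal) \<Rightarrow> real \<Rightarrow> ereal" where
  "right_lim f t = Lim (at_right t) f"

definition right_deriv :: "(real \<Rightarrow> ereal) \<Rightarrow> real \<Rightarrow> ereal" where
  "right_deriv f t =
     (if \<forall>s>t. f s = \<infinity> then \<infinity>
      else if \<exists>s>t. f s = -\<infinity> then -\<infinity>
      else Lim (at_right t) (\<lambda>s. (f s - f t) / ereal (s - t)))"

definition ereal_differentiable_at :: "(real \<Rightarrow> ereal) \<Rightarrow> real \<Rightarrow> bool" where
  "ereal_differentiable_at f t \<longleftrightarrow>
     (\<forall>\<^sub>F s in nhds t. \<bar>f s\<bar> \<noteq> \<infinity>) \<and> (\<lambda>s. real_of_ereal (f s)) differentiable (at t)"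

definition ereal_deriv :: "(real \<Rightarrow> ereal) \<Rightarrow> real \<Rightarrow> ereal" where
  "ereal_deriv f t = ereal (deriv (\<lambda>s. real_of_ereal (f s)) t)"

(* The left derivative of f at t, for f differentiable to the left of t, understood as the limit
   of the derivatives; the value of f at t itself plays no role. *)
definition left_deriv :: "(real \<Rightarrow> ereal) \<Rightarrow> real \<Rightarrow> ereal" where
  "left_deriv f t = Lim (at_left t) (ereal_deriv f)"

(* The Legendre-Fenchel transform.  At -\<infinity> it is the extension by continuity, meaningful when
   right_lim (right_deriv f) 0 = -\<infinity>.  The value at \<infinity> has no significance. *)
definition legendre :: "(real \<Rightarrow> ereal) \<Rightarrow> ereal \<Rightarrow> ereal" where
  "legendre f x = (if x = -\<infinity> then - right_lim f 0 else (SUP t. ereal t * x - f t))"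

definition affine_fun_on :: "real set \<Rightarrow> (real \<Rightarrow> ereal) \<Rightarrow> bool" where
  "affine_fun_on S f \<longleftrightarrow> (\<exists>p q. \<forall>s\<in>S. f s = ereal (p * s + q))"

definition linear_fun_on :: "real set \<Rightarrow> (real \<Rightarrow> ereal) \<Rightarrow> bool" where
  "linear_fun_on S f \<longleftrightarrow> (\<exists>p. \<forall>s\<in>S. f s = ereal (p * s))"

(* Inserting t makes the supremum equal to t when no s qualifies. *)
definition affine_end :: "(real \<Rightarrow> ereal) \<Rightarrow> real \<Rightarrow> ereal" where
  "affine_end f t = Sup (ereal ` insert t {s. t < s \<and> affine_fun_on {t<..s} f})"

definition strict_convex_on :: "real set \<Rightarrow> (real \<Rightarrow> real) \<Rightarrow> bool" where
  "strict_convex_on S f \<longleftrightarrow> convex S \<and>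
     (\<forall>x\<in>S. \<forall>y\<in>S. \<forall>u>0. \<forall>v>0. x \<noteq> y \<longrightarrow> u + v = 1 \<longrightarrow>
        f (u * x + v * y) < u * f x + v * f y)"

definition strict_concave_on :: "real set \<Rightarrow> (real \<Rightarrow> real) \<Rightarrow> bool" where
  "strict_concave_on S f \<longleftrightarrow> strict_convex_on S (\<lambda>x. - f x)"

end

theory Submission
  imports Defs
begin

text \<open>
  The value \<open>L(t+) - t z\<close> is the Chernoff exponent \<open>inf {L(s) - s z | s > 0}\<close>: the infimum is
  approached as \<open>s\<close> decreases to the point \<open>t\<close> to the right of which \<open>L\<close> has slope \<open>z\<close>.  So the upper
  bound for closed intervals is the exponential Markov inequality (lemma \<open>mgf_chernoff\<close>), and
  what has to be shown is the lower bound for open intervals.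

  For the lower bound let \<open>s\<close> be a point of the interval of differentiability with slope
  \<open>z' = L'(s)\<close> slightly larger than \<open>z\<close>.  Such points exist arbitrarily close to slope \<open>z\<close> because
  the supremum of \<open>L'\<close> is not attained.  Under the measures tilted by \<open>exp (s x / c)\<close> the mass
  outside any neighbourhood \<open>]w0,w1[\<close> of \<open>z'\<close> is exponentially negligible: moving the tilt from
  \<open>s\<close> to \<open>s + \<theta>\<close> and to \<open>s - \<theta>\<close> costs \<open>L(s \<plusminus> \<theta>)\<close>, which by differentiability at \<open>s\<close> is strictly
  less than \<open>L(s) + \<theta> w1\<close>, respectively \<open>L(s) - \<theta> w0\<close>, for small \<open>\<theta>\<close> (lemmas \<open>mgf_tilting\<close> and
  \<open>slope_gap\<close>).  At \<open>s \<plusminus> \<theta>\<close> upper bounds for the moment generating functions enter, and these hold eventually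
  since \<open>L\<close> is an upper limit.  The only lower bound is the one at \<open>s\<close>: it holds
  frequently along the net, which gives a bound for the upper limit, and it holds eventually
  when \<open>L(s)\<close> is a limit, which gives a bound for the lower limit.  This is why
  existence of \<open>L\<close> along one sequence is enough for the limits to exist.  The interval
  \<open>]w0,w1[\<close> eventually lies in \<open>]x,y[\<close>, so the probability has at least the exponent
  \<open>L(s) - s z'\<close>, and this tends to \<open>L(t+) - t z\<close> as \<open>z'\<close> decreases to \<open>z\<close>
  (lemma \<open>G_lower_right\<close>).

  Everything else is about the function \<open>L\<close> alone.  It is convex, since the bounds
  \<open>\<integral> exp (s x / c) \<le> exp (A / c)\<close> can be interpolated in \<open>s\<close> (lemma \<open>mgf_interpolation\<close>), and it
  never takes the value \<open>-\<infinity>\<close>, since this would spread to the interval where \<open>L\<close> is real.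
  Tangents at points of the interval therefore lie below \<open>L\<close> on the whole line, and letting
  the point of tangency decrease to \<open>t\<close> shows that \<open>s \<mapsto> L(t+) + z (s - t)\<close> lies below \<open>L\<close> too
  (lemma \<open>right_tangent\<close>).  This identifies \<open>L(t+) - t z\<close> with the transform
  \<open>G z = inf {L(s) - s z | s > 0}\<close> and with \<open>- L\<^sup>*(z)\<close>.  The assertions of part b) are the usual
  duality for \<open>G\<close>: it is an infimum of affine functions, the infimum at slope \<open>L'(t)\<close> is
  attained at \<open>t\<close> and at no point of a different slope, and where \<open>L'\<close> is strictly increasing, its
  inverse is \<open>- G'\<close>.
\<close>

section \<open>Exponential scale\<close>

text \<open>This equivalence and the next move bounds at the scale \<open>c log\<close> to bounds for integrals and
  probabilities themselves, which removes the values \<open>\<plusminus>\<infinity>\<close> of the logarithm from all estimates.\<close>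

lemma scaled_elog_le_iff:
  assumes "c > 0"
  shows "ereal c * elog m \<le> ereal B \<longleftrightarrow> m \<le> ennreal (exp (B / c))"
proof (cases m rule: ennreal_cases)
  case (real r)
  show ?thesis
  proof (cases "r = 0")
    case True
    then show ?thesis using real assms by (simp add: elog_def)
  next
    case False
    then have "r > 0" using real by simp
    then have "c * ln r \<le> B \<longleftrightarrow> r \<le> exp (B / c)"
      using assms by (metis exp_le_cancel_iff exp_ln mult.commute pos_le_divide_eq)
    then show ?thesis using real False \<open>r > 0\<close> by (simp add: elog_def)
  qed
next
  case top
  then show ?thesis using assms by (simp add: elog_def top_unique)
qed

lemma scaled_elog_ge_iff:
  assumes "c > 0"
  shows "ereal B \<le> ereal c * elog m \<longleftrightarrow> ennreal (exp (B / c)) \<le> m"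
proof (cases m rule: ennreal_cases)
  case (real r)
  show ?thesis
  proof (cases "r = 0")
    case True
    then show ?thesis using real assms by (simp add: elog_def)
  next
    case False
    then have "r > 0" using real by simp
    then have "B \<le> c * ln r \<longleftrightarrow> exp (B / c) \<le> r"
      using assms by (metis exp_le_cancel_iff exp_ln mult.commute pos_divide_le_eq)
    then show ?thesis using real False \<open>r > 0\<close> by (simp add: elog_def)
  qed
next
  case top
  then show ?thesis using assms by (simp add: elog_def)
qed

lemma scaled_elog_mono:
  assumes "c > 0" "m \<le> m'"
  shows "ereal c * elog m \<le> ereal c * elog m'"
proof (rule ereal_le_real)
  fix B assume "ereal c * elog m' \<le> ereal B"
  then show "ereal c * elog m \<le> ereal B"
    using assms by (auto simp: scaled_elog_le_iff intro: order_trans)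
qed

lemma scaled_log_mgf_le_iff:
  assumes "c i > 0"
  shows "scaled_log_mgf \<mu> c t i \<le> ereal B \<longleftrightarrow>
    (\<integral>\<^sup>+ x. ennreal (exp (inverse (c i) * t * x)) \<partial>\<mu> i) \<le> ennreal (exp (B / c i))"
  using assms unfolding scaled_log_mgf_def by (rule scaled_elog_le_iff)

lemma scaled_log_prob_eq:
  assumes "sets (\<mu> i) = sets borel" and "A i \<in> sets borel"
  shows "scaled_log_prob \<mu> c A i = ereal (c i) * elog (emeasure (\<mu> i) (ereal -` A i))"
proof -
  have [simp]: "space (\<mu> i) = UNIV"
    using sets_eq_imp_space_eq[OF assms(1)] by simp
  have "ereal \<in> measurable (\<mu> i) borel"
    unfolding measurable_cong_sets[OF assms(1) refl] by simp
  then show ?thesis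
    using assms(2) by (simp add: scaled_log_prob_def emeasure_distr)
qed

section \<open>Estimates for one measure\<close>

lemma mgf_chernoff:
  fixes M :: "real measure"
  assumes M: "sets M = sets borel" and "c > 0" and "s \<ge> 0"
    and B: "(\<integral>\<^sup>+ x. ennreal (exp (inverse c * s * x)) \<partial>M) \<le> ennreal (exp (B / c))"
  shows "emeasure M {w..} \<le> ennreal (exp ((B - s * w) / c))"
proof -
  note [measurable_cong] = M
  have "emeasure M {w..} = (\<integral>\<^sup>+ x. indicator {w..} x \<partial>M)"
    using M by simp
  also have "\<dots> \<le> (\<integral>\<^sup>+ x. ennreal (exp (- (s * w) / c)) * ennreal (exp (inverse c * s * x)) \<partial>M)"
  proof (intro nn_integral_mono)
    fix x
    show "indicator {w..} x \<le> ennreal (exp (- (s * w) / c)) * ennreal (exp (inverse c * s * x))"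
    proof (cases "w \<le> x")
      case True
      have "exp (- (s * w) / c) * exp (inverse c * s * x) = exp (s * (x - w) / c)"
        using \<open>c > 0\<close> by (simp add: exp_add[symmetric] field_simps)
      moreover have "1 \<le> exp (s * (x - w) / c)"
        using True assms(2,3) by simp
      ultimately show ?thesis
        using True by (simp add: ennreal_mult[symmetric] ennreal_1[symmetric] del: ennreal_1)
    qed simp
  qed
  also have "\<dots> = ennreal (exp (- (s * w) / c)) * (\<integral>\<^sup>+ x. ennreal (exp (inverse c * s * x)) \<partial>M)"
    by (rule nn_integral_cmult) simp
  also have "\<dots> \<le> ennreal (exp (- (s * w) / c)) * ennreal (exp (B / c))"
    by (intro mult_left_mono B) simp
  also have "\<dots> = ennreal (exp ((B - s * w) / c))"
    by (simp add: ennreal_mult[symmetric] exp_add[symmetric] diff_divide_distrib)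
  finally show ?thesis .
qed

text \<open>Normalised by their bounds, both integrands have integral at most 1, and convexity of the
  exponential bounds the interpolated integrand pointwise by their convex combination.  This is
  Hoelder's inequality for integrals given by upper bounds.\<close>

lemma mgf_interpolation:
  fixes M :: "real measure"
  assumes M: "sets M = sets borel" and "c > 0" and uv: "u \<ge> 0" "v \<ge> 0" "u + v = 1"
    and A: "(\<integral>\<^sup>+ x. ennreal (exp (inverse c * s * x)) \<partial>M) \<le> ennreal (exp (A / c))"
    and B: "(\<integral>\<^sup>+ x. ennreal (exp (inverse c * t * x)) \<partial>M) \<le> ennreal (exp (B / c))"
  shows "(\<integral>\<^sup>+ x. ennreal (exp (inverse c * (u * s + v * t) * x)) \<partial>M)
    \<le> ennreal (exp ((u * A + v * B) / c))"
proof -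
  note [measurable_cong] = M
  define K where "K = exp ((u * A + v * B) / c)"
  have "(\<integral>\<^sup>+ x. ennreal (exp (inverse c * (u * s + v * t) * x)) \<partial>M)
    \<le> (\<integral>\<^sup>+ x. ennreal (K * u * exp (- A / c)) * ennreal (exp (inverse c * s * x))
        + ennreal (K * v * exp (- B / c)) * ennreal (exp (inverse c * t * x)) \<partial>M)"
  proof (intro nn_integral_mono)
    fix x
    let ?p = "inverse c * s * x - A / c" and ?q = "inverse c * t * x - B / c"
    have conv: "exp (u * ?p + v * ?q) \<le> u * exp ?p + v * exp ?q"
    proof -
      have "exp ((1 - v) * ?p + v * ?q) \<le> (1 - v) * exp ?p + v * exp ?q"
        using convex_onD[OF exp_convex, of v ?p ?q] uv by simp
      moreover have "1 - v = u" using uv by simp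
      ultimately show ?thesis by simp
    qed
    have "exp (inverse c * (u * s + v * t) * x) = K * exp (u * ?p + v * ?q)"
      unfolding K_def exp_add[symmetric]
      by (simp add: algebra_simps add_divide_distrib diff_divide_distrib)
    also have "\<dots> \<le> K * (u * exp ?p + v * exp ?q)"
      using conv by (intro mult_left_mono) (simp_all add: K_def)
    also have "\<dots> = K * u * exp (- A / c) * exp (inverse c * s * x)
        + K * v * exp (- B / c) * exp (inverse c * t * x)"
    proof -
      have p: "exp ?p = exp (- A / c) * exp (inverse c * s * x)"
        and q: "exp ?q = exp (- B / c) * exp (inverse c * t * x)"
        unfolding exp_add[symmetric] by simp_all
      show ?thesis unfolding p q by (simp only: distrib_left mult.assoc)
    qed
    finally have "exp (inverse c * (u * s + v * t) * x) \<le> \<dots>" .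
    then show "ennreal (exp (inverse c * (u * s + v * t) * x))
      \<le> ennreal (K * u * exp (- A / c)) * ennreal (exp (inverse c * s * x))
        + ennreal (K * v * exp (- B / c)) * ennreal (exp (inverse c * t * x))"
      using uv by (simp add: ennreal_mult[symmetric] ennreal_plus[symmetric] K_def del: ennreal_plus)
  qed
  also have "\<dots> = ennreal (K * u * exp (- A / c)) * (\<integral>\<^sup>+ x. ennreal (exp (inverse c * s * x)) \<partial>M)
        + ennreal (K * v * exp (- B / c)) * (\<integral>\<^sup>+ x. ennreal (exp (inverse c * t * x)) \<partial>M)"
    by (subst nn_integral_add) (auto simp: nn_integral_cmult)
  also have "\<dots> \<le> ennreal (K * u * exp (- A / c)) * ennreal (exp (A / c))
        + ennreal (K * v * exp (- B / c)) * ennreal (exp (B / c))"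
    by (intro add_mono mult_left_mono A B) simp_all
  also have "\<dots> = ennreal (K * u + K * v)"
    using uv by (simp add: ennreal_mult[symmetric] ennreal_plus[symmetric] K_def mult.assoc
        exp_add[symmetric] del: ennreal_plus)
  also have "\<dots> = ennreal K"
    using uv(3) by (metis distrib_left mult.right_neutral)
  finally show ?thesis by (simp add: K_def)
qed

text \<open>The line splits into \<open>]w0,w1[\<close> and its two complementary rays.  On the rays the exponential of
  slope \<open>s\<close> is at most a constant times the exponential of slope \<open>s + \<theta>\<close>, respectively \<open>s - \<theta>\<close>, and the
  bounds with the gain \<open>\<eta>\<close> make each of the two contributions at most a quarter of
  \<open>exp (A / c)\<close>.  Half of the total is left for \<open>]w0,w1[\<close>, where the integrand is at most
  \<open>exp (s w1 / c)\<close>.\<close>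

lemma mgf_tilting:
  fixes M :: "real measure"
  assumes M: "sets M = sets borel" and "c > 0" and "s \<ge> 0" and "\<theta> \<ge> 0"
    and A: "ennreal (exp (A / c)) < (\<integral>\<^sup>+ x. ennreal (exp (inverse c * s * x)) \<partial>M)"
    and up: "(\<integral>\<^sup>+ x. ennreal (exp (inverse c * (s + \<theta>) * x)) \<partial>M)
      \<le> ennreal (exp ((A - \<eta> + \<theta> * w1) / c))"
    and lo: "(\<integral>\<^sup>+ x. ennreal (exp (inverse c * (s - \<theta>) * x)) \<partial>M)
      \<le> ennreal (exp ((A - \<eta> - \<theta> * w0) / c))"
    and small: "exp (- \<eta> / c) \<le> 1 / 4"
  shows "ennreal (exp ((A - s * w1 - c * ln 2) / c)) \<le> emeasure M {w0<..<w1}"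
proof -
  note [measurable_cong] = M
  define m where "m = emeasure M {w0<..<w1}"
  have "(\<integral>\<^sup>+ x. ennreal (exp (inverse c * s * x)) \<partial>M)
    \<le> (\<integral>\<^sup>+ x. ennreal (exp (s * w1 / c)) * indicator {w0<..<w1} x
        + (ennreal (exp (- \<theta> * w1 / c)) * ennreal (exp (inverse c * (s + \<theta>) * x))
          + ennreal (exp (\<theta> * w0 / c)) * ennreal (exp (inverse c * (s - \<theta>) * x))) \<partial>M)"
  proof (intro nn_integral_mono)
    fix x
    have e1: "ennreal (exp (- \<theta> * w1 / c)) * ennreal (exp (inverse c * (s + \<theta>) * x))
        = ennreal (exp (inverse c * s * x + \<theta> * (x - w1) / c))"
      using \<open>c > 0\<close> by (simp add: ennreal_mult[symmetric] exp_add[symmetric] field_simps)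
    have e2: "ennreal (exp (\<theta> * w0 / c)) * ennreal (exp (inverse c * (s - \<theta>) * x))
        = ennreal (exp (inverse c * s * x + \<theta> * (w0 - x) / c))"
      using \<open>c > 0\<close> by (simp add: ennreal_mult[symmetric] exp_add[symmetric] field_simps)
    consider "x \<ge> w1" | "x \<le> w0" | "w0 < x" "x < w1" by linarith
    then show "ennreal (exp (inverse c * s * x))
      \<le> ennreal (exp (s * w1 / c)) * indicator {w0<..<w1} x
        + (ennreal (exp (- \<theta> * w1 / c)) * ennreal (exp (inverse c * (s + \<theta>) * x))
          + ennreal (exp (\<theta> * w0 / c)) * ennreal (exp (inverse c * (s - \<theta>) * x)))"
    proof cases
      case 1
      then have "ennreal (exp (inverse c * s * x)) \<le> ennreal (exp (inverse c * s * x + \<theta> * (x - w1) / c))"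
        using \<open>c > 0\<close> \<open>\<theta> \<ge> 0\<close> by (intro ennreal_leI) simp
      then show ?thesis unfolding e1 by (simp add: add_increasing add_increasing2)
    next
      case 2
      then have "ennreal (exp (inverse c * s * x)) \<le> ennreal (exp (inverse c * s * x + \<theta> * (w0 - x) / c))"
        using \<open>c > 0\<close> \<open>\<theta> \<ge> 0\<close> by (intro ennreal_leI) simp
      then show ?thesis unfolding e2 by (simp add: add_increasing add_increasing2)
    next
      case 3
      then have "s * x \<le> s * w1" using \<open>s \<ge> 0\<close> by (intro mult_left_mono) auto
      then have "ennreal (exp (inverse c * s * x)) \<le> ennreal (exp (s * w1 / c))"
        using \<open>c > 0\<close> by (intro ennreal_leI) (simp add: divide_simps)
      then show ?thesis using 3 by (simp add: add_increasing2)
    qed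
  qed
  also have "\<dots> = ennreal (exp (s * w1 / c)) * m
      + (ennreal (exp (- \<theta> * w1 / c)) * (\<integral>\<^sup>+ x. ennreal (exp (inverse c * (s + \<theta>) * x)) \<partial>M)
        + ennreal (exp (\<theta> * w0 / c)) * (\<integral>\<^sup>+ x. ennreal (exp (inverse c * (s - \<theta>) * x)) \<partial>M))"
    using M by (subst nn_integral_add, simp, simp, subst nn_integral_add)
      (auto simp: nn_integral_cmult m_def nn_integral_cmult_indicator)
  also have "\<dots> \<le> ennreal (exp (s * w1 / c)) * m
      + (ennreal (exp (- \<theta> * w1 / c)) * ennreal (exp ((A - \<eta> + \<theta> * w1) / c))
        + ennreal (exp (\<theta> * w0 / c)) * ennreal (exp ((A - \<eta> - \<theta> * w0) / c)))"
    by (intro add_mono mult_left_mono up lo order_refl) simp_all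
  also have "\<dots> = ennreal (exp (s * w1 / c)) * m + ennreal (2 * (exp (A / c) * exp (- \<eta> / c)))"
  proof -
    have "exp (- \<theta> * w1 / c) * exp ((A - \<eta> + \<theta> * w1) / c) = exp (A / c) * exp (- \<eta> / c)"
      "exp (\<theta> * w0 / c) * exp ((A - \<eta> - \<theta> * w0) / c) = exp (A / c) * exp (- \<eta> / c)"
      unfolding exp_add[symmetric] by (simp_all add: add_divide_distrib diff_divide_distrib)
    then show ?thesis
      by (simp add: ennreal_mult[symmetric] ennreal_plus[symmetric] del: ennreal_plus)
  qed
  also have "\<dots> \<le> ennreal (exp (s * w1 / c)) * m + ennreal (exp (A / c) / 2)"
  proof (intro add_mono order_refl ennreal_leI)
    have "exp (A / c) * exp (- \<eta> / c) \<le> exp (A / c) * (1 / 4)"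
      using small by (intro mult_left_mono) auto
    then show "2 * (exp (A / c) * exp (- \<eta> / c)) \<le> exp (A / c) / 2" by simp
  qed
  finally have main: "(\<integral>\<^sup>+ x. ennreal (exp (inverse c * s * x)) \<partial>M)
      \<le> ennreal (exp (s * w1 / c)) * m + ennreal (exp (A / c) / 2)" .
  have goal_eq: "exp ((A - s * w1 - c * ln 2) / c) = exp (A / c) / 2 / exp (s * w1 / c)"
    using \<open>c > 0\<close> by (simp add: diff_divide_distrib exp_diff)
  show ?thesis
  proof (cases m rule: ennreal_cases)
    case (real r)
    have "ennreal (exp (A / c)) < ennreal (exp (s * w1 / c) * r + exp (A / c) / 2)"
      using less_le_trans[OF A main] real by (simp add: ennreal_mult ennreal_plus)
    then have "exp (A / c) < exp (s * w1 / c) * r + exp (A / c) / 2"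
      using real by (simp add: ennreal_less_iff ennreal_plus[symmetric] del: ennreal_plus)
    then have "exp (A / c) / 2 / exp (s * w1 / c) \<le> r"
      by (simp add: field_simps)
    then show ?thesis using real unfolding goal_eq m_def[symmetric] by (simp add: ennreal_leI)
  next
    case top
    then show ?thesis by (simp add: m_def)
  qed
qed

section \<open>Limits along the net\<close>

lemma net_filter_nontrivial:
  assumes "directed_set D le"
  shows "net_filter D le \<noteq> bot"
proof -
  have "eventually P (net_filter D le) \<longleftrightarrow> (\<exists>i\<in>D. eventually P (principal {j \<in> D. le i j}))" for P
    unfolding net_filter_def
  proof (rule eventually_INF_base)
    show "D \<noteq> {}" using assms by (simp add: directed_set_def)
    show "\<exists>k\<in>D. principal {j \<in> D. le k j} \<le> inf (principal {l \<in> D. le i l}) (principal {l \<in> D. le j l})"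
      if ij: "i \<in> D" "j \<in> D" for i j
    proof -
      obtain k where k: "k \<in> D" "le i k" "le j k"
        using assms ij unfolding directed_set_def by meson
      have "le i l \<and> le j l" if "l \<in> D" "le k l" for l
        using assms k \<open>i \<in> D\<close> \<open>j \<in> D\<close> that unfolding directed_set_def by meson
      then have "principal {j \<in> D. le k j} \<le> inf (principal {l \<in> D. le i l}) (principal {l \<in> D. le j l})"
        by (simp add: inf_principal) blast
      with k(1) show ?thesis by (rule bexI[rotated])
    qed
  qed
  from this[of "\<lambda>_. False"] have "eventually (\<lambda>_. False) (net_filter D le) \<longleftrightarrow> (\<exists>i\<in>D. {j \<in> D. le i j} = {})"
    by (simp add: eventually_principal)
  moreover have "i \<in> {j \<in> D. le i j}" if "i \<in> D" for i
    using assms that by (simp add: directed_set_def)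
  ultimately show ?thesis
    unfolding trivial_limit_def by (metis empty_iff)
qed

lemma eventually_net_filter_mem:
  assumes "directed_set D le"
  shows "eventually (\<lambda>i. i \<in> D) (net_filter D le)"
proof -
  obtain i where "i \<in> D" using assms by (auto simp: directed_set_def)
  then have "net_filter D le \<le> principal {j \<in> D. le i j}"
    unfolding net_filter_def by (rule INF_lower)
  then show ?thesis by (rule filter_leD) (simp add: eventually_principal)
qed

locale scaled_prob_net =
  fixes F :: "'i filter" and \<mu> :: "'i \<Rightarrow> real measure" and c :: "'i \<Rightarrow> real"
  assumes nontrivial: "F \<noteq> bot"
    and eventually_prob: "\<forall>\<^sub>F i in F. prob_space (\<mu> i) \<and> sets (\<mu> i) = sets borel \<and> 0 < c i"
    and scale_tendsto: "(c \<longlongrightarrow> 0) F"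
begin

abbreviation L :: "real \<Rightarrow> ereal" where
  "L \<equiv> upper_log_mgf F \<mu> c"

lemma upper_log_mgf_zero: "L 0 = 0"
proof -
  have "\<forall>\<^sub>F i in F. scaled_log_mgf \<mu> c 0 i = 0"
    using eventually_prob
  proof eventually_elim
    case (elim i)
    then interpret prob_space "\<mu> i" by simp
    show ?case by (simp add: scaled_log_mgf_def elog_def emeasure_space_1)
  qed
  then have "L 0 = Limsup F (\<lambda>_. 0)"
    unfolding upper_log_mgf_def by (rule Limsup_eq)
  then show ?thesis using nontrivial by (simp add: Limsup_const)
qed

lemma upper_log_mgf_less_eventually:
  assumes "L s < ereal B"
  shows "\<forall>\<^sub>F i in F. (\<integral>\<^sup>+ x. ennreal (exp (inverse (c i) * s * x)) \<partial>\<mu> i) \<le> ennreal (exp (B / c i))"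
proof -
  have "\<forall>\<^sub>F i in F. scaled_log_mgf \<mu> c s i < ereal B"
    using assms unfolding upper_log_mgf_def by (rule Limsup_lessD)
  with eventually_prob show ?thesis
    by eventually_elim (simp add: scaled_log_mgf_le_iff[symmetric] less_imp_le)
qed

text \<open>Bounding by strict real upper bounds \<open>A\<close> and \<open>B\<close> states convexity without sums
  \<open>\<infinity> - \<infinity>\<close>, and covers the value \<open>-\<infinity>\<close>.\<close>

lemma upper_log_mgf_convex:
  assumes "L s < ereal A" "L t < ereal B" and uv: "0 \<le> u" "0 \<le> v" "u + v = 1"
  shows "L (u * s + v * t) \<le> ereal (u * A + v * B)"
  unfolding upper_log_mgf_def
proof (rule Limsup_bounded)
  show "\<forall>\<^sub>F i in F. scaled_log_mgf \<mu> c (u * s + v * t) i \<le> ereal (u * A + v * B)"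
    using eventually_prob upper_log_mgf_less_eventually[OF assms(1)]
      upper_log_mgf_less_eventually[OF assms(2)]
  proof eventually_elim
    case (elim i)
    then show ?case
      using mgf_interpolation[of "\<mu> i" "c i" u v s A t B] uv by (simp add: scaled_log_mgf_le_iff)
  qed
qed

lemma scaled_log_prob_nonpos: "\<forall>\<^sub>F i in F. \<forall>A. scaled_log_prob \<mu> c A i \<le> 0"
  using eventually_prob
proof eventually_elim
  case (elim i)
  then have sets_i: "sets (\<mu> i) = sets borel" by simp
  from elim interpret prob_space "\<mu> i" by simp
  have [measurable]: "ereal \<in> measurable (\<mu> i) borel"
    unfolding measurable_cong_sets[OF sets_i refl] by simp
  interpret E: prob_space "distr (\<mu> i) borel ereal" by (rule prob_space_distr) simp
  show ?case
  proof
    fix A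
    have "ereal (c i) * elog (emeasure (distr (\<mu> i) borel ereal) (A i)) \<le> ereal 0"
      using elim E.emeasure_le_1 by (subst scaled_elog_le_iff) simp_all
    then show "scaled_log_prob \<mu> c A i \<le> 0"
      by (simp only: scaled_log_prob_def zero_ereal_def)
  qed
qed

text \<open>Chernoff's bound at the fixed point \<open>w\<close> slightly below \<open>z\<close>, beyond which \<open>x\<close> eventually stays.\<close>

lemma Limsup_scaled_log_prob_upper:
  assumes "s \<ge> 0" and "L s < ereal B" and x: "(x \<longlongrightarrow> ereal z) F"
  shows "Limsup F (scaled_log_prob \<mu> c (\<lambda>i. {x i..y i})) \<le> ereal (B - s * z)"
proof (rule ereal_le_epsilon2)
  fix e :: real
  assume "0 < e"
  \<comment> \<open>The denominator is \<open>s + 1\<close> because \<open>s\<close> may vanish.\<close>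
  define w where "w = z - e / (s + 1)"
  have "w < z" using \<open>0 < e\<close> \<open>s \<ge> 0\<close> by (simp add: w_def)
  have "s * e / (s + 1) \<le> e" using \<open>0 < e\<close> \<open>s \<ge> 0\<close> by (simp add: divide_simps)
  then have sw: "B - s * w \<le> B - s * z + e" by (simp add: w_def right_diff_distrib)
  have "\<forall>\<^sub>F i in F. ereal w < x i"
    using order_tendstoD(1)[OF x] \<open>w < z\<close> by simp
  then have "\<forall>\<^sub>F i in F. scaled_log_prob \<mu> c (\<lambda>i. {x i..y i}) i \<le> ereal (B - s * z + e)"
    using eventually_prob upper_log_mgf_less_eventually[OF assms(2)]
  proof eventually_elim
    case (elim i)
    then have sets_i: "sets (\<mu> i) = sets borel" and "0 < c i" by auto
    have "ereal -` {x i..y i} \<subseteq> {w..}"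
      using elim(1) by (auto dest: less_le_trans)
    then have "emeasure (\<mu> i) (ereal -` {x i..y i}) \<le> emeasure (\<mu> i) {w..}"
      using sets_i by (intro emeasure_mono) auto
    also have "\<dots> \<le> ennreal (exp ((B - s * w) / c i))"
      by (rule mgf_chernoff[OF sets_i \<open>0 < c i\<close> assms(1) elim(3)])
    also have "\<dots> \<le> ennreal (exp ((B - s * z + e) / c i))"
      using sw \<open>0 < c i\<close> by (intro ennreal_leI) (simp add: divide_right_mono)
    finally show ?case
      using \<open>0 < c i\<close> sets_i by (simp add: scaled_log_prob_eq scaled_elog_le_iff)
  qed
  then show "Limsup F (scaled_log_prob \<mu> c (\<lambda>i. {x i..y i})) \<le> ereal (B - s * z) + ereal e"
    by (simp add: Limsup_bounded)
qed

text \<open>The lower bound for the moment generating function at \<open>s\<close> is kept as a hypothesis inside the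
  eventuality, because it is available only frequently or eventually, depending on whether the
  upper limit at \<open>s\<close> is a limit.\<close>

lemma eventually_scaled_log_prob_lower:
  assumes "s \<ge> 0" "\<theta> > 0" "\<eta> > 0"
    and up: "L (s + \<theta>) < ereal (A - \<eta> + \<theta> * w1)"
    and lo: "L (s - \<theta>) < ereal (A - \<eta> - \<theta> * w0)"
    and x: "(x \<longlongrightarrow> z) F" "z < ereal w0" and y: "ereal w1 < Liminf F y"
    and "e > 0"
  shows "\<forall>\<^sub>F i in F. ereal A < scaled_log_mgf \<mu> c s i \<longrightarrow>
    ereal (A - s * w1 - e) \<le> scaled_log_prob \<mu> c (\<lambda>i. {x i<..<y i}) i"
proof -
  have "\<forall>\<^sub>F i in F. x i < ereal w0" using order_tendstoD(2)[OF x] .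
  moreover have "\<forall>\<^sub>F i in F. ereal w1 < y i" using less_LiminfD[OF y] .
  moreover have "\<forall>\<^sub>F i in F. c i < e / ln 2"
    using order_tendstoD(2)[OF scale_tendsto] \<open>e > 0\<close> by simp
  moreover have "\<forall>\<^sub>F i in F. c i < \<eta> / ln 4"
    using order_tendstoD(2)[OF scale_tendsto] \<open>\<eta> > 0\<close> by simp
  ultimately show ?thesis
    using eventually_prob upper_log_mgf_less_eventually[OF up] upper_log_mgf_less_eventually[OF lo]
  proof eventually_elim
    case (elim i)
    then have sets_i: "sets (\<mu> i) = sets borel" and "0 < c i" by auto
    have ce: "c i * ln 2 \<le> e" using elim(3) by (simp add: pos_less_divide_eq)
    have "ln 4 \<le> \<eta> / c i" using elim(4) \<open>0 < c i\<close> by (simp add: field_simps)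
    then have small: "exp (- \<eta> / c i) \<le> 1 / 4"
    proof -
      have "exp (- \<eta> / c i) \<le> exp (- ln 4)" using \<open>ln 4 \<le> \<eta> / c i\<close> by simp
      then show ?thesis by (simp add: exp_minus)
    qed
    show ?case
    proof
      assume "ereal A < scaled_log_mgf \<mu> c s i"
      then have "ennreal (exp (A / c i)) < (\<integral>\<^sup>+ x. ennreal (exp (inverse (c i) * s * x)) \<partial>\<mu> i)"
        using scaled_log_mgf_le_iff[of c i \<mu> s A] \<open>0 < c i\<close> by (simp add: not_le[symmetric])
      then have "ennreal (exp ((A - s * w1 - c i * ln 2) / c i)) \<le> emeasure (\<mu> i) {w0<..<w1}"
        using mgf_tilting[OF sets_i \<open>0 < c i\<close> \<open>s \<ge> 0\<close> _ _ elim(6,7) small] \<open>\<theta> > 0\<close> by simp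
      also have "\<dots> \<le> emeasure (\<mu> i) (ereal -` {x i<..<y i})"
      proof (rule emeasure_mono)
        show "{w0<..<w1} \<subseteq> ereal -` {x i<..<y i}"
        proof
          fix r assume "r \<in> {w0<..<w1}"
          then have "ereal w0 < ereal r" "ereal r < ereal w1" by simp_all
          then have "x i < ereal r" "ereal r < y i"
            using elim(1,2) less_trans by blast+
          then show "r \<in> ereal -` {x i<..<y i}" by simp
        qed
        have "ereal -` {x i<..<y i} \<in> sets borel"
          by (intro borel_open open_vimage continuous_on_ereal continuous_on_id) simp
        then show "ereal -` {x i<..<y i} \<in> sets (\<mu> i)" using sets_i by simp
      qed
      finally have "ereal (A - s * w1 - c i * ln 2) \<le> scaled_log_prob \<mu> c (\<lambda>i. {x i<..<y i}) i"
        using \<open>0 < c i\<close> sets_i by (simp add: scaled_log_prob_eq scaled_elog_ge_iff)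
      moreover have "ereal (A - s * w1 - e) \<le> ereal (A - s * w1 - c i * ln 2)"
        using ce by simp
      ultimately show "ereal (A - s * w1 - e) \<le> scaled_log_prob \<mu> c (\<lambda>i. {x i<..<y i}) i"
        by (rule order_trans[rotated])
    qed
  qed
qed

end

section \<open>One-sided limits of monotone functions\<close>

lemma mono_tendsto_at_right_INF:
  fixes h :: "real \<Rightarrow> ereal"
  assumes "t < e" and mono: "\<And>r s. t < r \<Longrightarrow> r \<le> s \<Longrightarrow> s < e \<Longrightarrow> h r \<le> h s"
  shows "(h \<longlongrightarrow> (INF s\<in>{t<..<e}. h s)) (at_right t)"
proof (rule order_tendstoI)
  fix l assume "l < (INF s\<in>{t<..<e}. h s)"
  then have "l < h s" if "s \<in> {t<..<e}" for s
    using that by (meson INF_lower less_le_trans)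
  then show "\<forall>\<^sub>F s in at_right t. l < h s"
    using \<open>t < e\<close> by (auto simp: eventually_at_right)
next
  fix u assume "(INF s\<in>{t<..<e}. h s) < u"
  then obtain s where s: "t < s" "s < e" "h s < u" by (auto simp: INF_less_iff)
  then have "h r < u" if "t < r" "r < s" for r
    using that mono[of r s] by (meson le_less_trans less_imp_le)
  then show "\<forall>\<^sub>F s in at_right t. h s < u"
    using s(1) by (auto simp: eventually_at_right)
qed

lemma antimono_tendsto_at_right_SUP:
  fixes h :: "real \<Rightarrow> ereal"
  assumes "t < e" and anti: "\<And>r s. t < r \<Longrightarrow> r \<le> s \<Longrightarrow> s < e \<Longrightarrow> h s \<le> h r"
  shows "(h \<longlongrightarrow> (SUP s\<in>{t<..<e}. h s)) (at_right t)"
proof (rule order_tendstoI)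
  fix u assume "(SUP s\<in>{t<..<e}. h s) < u"
  then have "h s < u" if "s \<in> {t<..<e}" for s
    using that by (meson SUP_upper le_less_trans)
  then show "\<forall>\<^sub>F s in at_right t. h s < u"
    using \<open>t < e\<close> by (auto simp: eventually_at_right)
next
  fix l assume "l < (SUP s\<in>{t<..<e}. h s)"
  then obtain s where s: "t < s" "s < e" "l < h s" by (auto simp: less_SUP_iff)
  then have "l < h r" if "t < r" "r < s" for r
    using that anti[of r s] by (meson less_le_trans less_imp_le)
  then show "\<forall>\<^sub>F s in at_right t. l < h s"
    using s(1) by (auto simp: eventually_at_right)
qed

lemma mono_tendsto_at_left_SUP:
  fixes h :: "real \<Rightarrow> ereal"
  assumes "t < e" and mono: "\<And>r s. t < r \<Longrightarrow> r \<le> s \<Longrightarrow> s < e \<Longrightarrow> h r \<le> h s"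
  shows "(h \<longlongrightarrow> (SUP s\<in>{t<..<e}. h s)) (at_left e)"
proof (rule order_tendstoI)
  fix u assume "(SUP s\<in>{t<..<e}. h s) < u"
  then have "h s < u" if "s \<in> {t<..<e}" for s
    using that by (meson SUP_upper le_less_trans)
  then show "\<forall>\<^sub>F s in at_left e. h s < u"
    using \<open>t < e\<close> by (auto simp: eventually_at_left)
next
  fix l assume "l < (SUP s\<in>{t<..<e}. h s)"
  then obtain s where s: "t < s" "s < e" "l < h s" by (auto simp: less_SUP_iff)
  then have "l < h r" if "s < r" "r < e" for r
    using that mono[of s r] by (meson less_le_trans less_imp_le)
  then show "\<forall>\<^sub>F s in at_left e. l < h s"
    using s(2) by (auto simp: eventually_at_left)
qed

section \<open>The convex function and its derivative\<close>

text \<open>The hypotheses on the log-moment generating function that do not refer to measures.  Convexity is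
  expressed through strict real upper bounds, since \<open>L\<close> may take infinite values.\<close>

locale differentiable_convex =
  fixes L :: "real \<Rightarrow> ereal" and lam eps :: real
  assumes L_convex: "\<And>s t A B u v. L s < ereal A \<Longrightarrow> L t < ereal B \<Longrightarrow> 0 \<le> u \<Longrightarrow> 0 \<le> v \<Longrightarrow> u + v = 1
      \<Longrightarrow> L (u * s + v * t) \<le> ereal (u * A + v * B)"
    and L_zero: "L 0 = 0"
    and lam_nonneg: "0 \<le> lam" and eps_pos: "0 < eps"
    and L_differentiable: "\<And>t. t \<in> {lam<..<lam + eps} \<Longrightarrow> ereal_differentiable_at L t"
    and not_maximum: "(SUP t\<in>{lam<..<lam + eps}. ereal_deriv L t) \<notin> ereal_deriv L ` {lam<..<lam + eps}"
    and right_continuous: "lam = 0 \<Longrightarrow> right_lim (right_deriv L) 0 = -\<infinity> \<Longrightarrow> continuous (at_right 0) L"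
begin

abbreviation I :: "real set" where "I \<equiv> {lam<..<lam + eps}"

definition f :: "real \<Rightarrow> real" where "f = (\<lambda>t. real_of_ereal (L t))"
definition d :: "real \<Rightarrow> real" where "d = deriv f"

text \<open>The effective domain of \<open>L\<close>.\<close>

definition E :: "real set" where "E = {t. L t \<noteq> \<infinity>}"

abbreviation slope :: "real \<Rightarrow> ereal" where "slope \<equiv> right_lim (right_deriv L)"
abbreviation a :: ereal where "a \<equiv> slope lam"
abbreviation b :: ereal where "b \<equiv> left_deriv L (lam + eps)"

lemma L_eq_on_I: "t \<in> I \<Longrightarrow> L t = ereal (f t)"
  using L_differentiable[of t]
  unfolding ereal_differentiable_at_def f_def
  by (auto dest!: eventually_nhds_x_imp_x simp: ereal_real)

lemma f_has_derivative:
  assumes "t \<in> I"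
  shows "(f has_real_derivative d t) (at t)"
  using L_differentiable[OF assms] unfolding ereal_differentiable_at_def d_def f_def
  by (simp add: DERIV_deriv_iff_real_differentiable)

text \<open>By convexity a value \<open>-\<infinity>\<close> would spread to a point of \<open>I\<close>: one that lies strictly
  between the given point and another point of \<open>I\<close>.\<close>

lemma L_not_MInf: "L s \<noteq> -\<infinity>"
proof
  assume s: "L s = -\<infinity>"
  have no: False if t: "t \<in> I" and p: "p \<in> I" and between: "s < p \<and> p < t \<or> t < p \<and> p < s" for t p
  proof -
    define u where "u = (p - t) / (s - t)"
    have u: "0 < u" "u \<le> 1" "u * s + (1 - u) * t = p"
      using between by (auto simp: u_def divide_simps) (auto simp: algebra_simps)
    \<comment> \<open>\<open>A\<close> is low enough for the convexity bound at \<open>p\<close> to be \<open>f p - 1\<close>.\<close>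
    define A where "A = (f p - 1 - (1 - u) * (f t + 1)) / u"
    have "L (u * s + (1 - u) * t) \<le> ereal (u * A + (1 - u) * (f t + 1))"
      using u s L_eq_on_I[OF t] by (intro L_convex) auto
    then have "f p \<le> u * A + (1 - u) * (f t + 1)" using u(3) L_eq_on_I[OF p] by simp
    moreover have "u * A = f p - 1 - (1 - u) * (f t + 1)" using u(1) by (simp add: A_def)
    ultimately show False by simp
  qed
  have I: "lam + eps / 4 \<in> I" "lam + eps / 2 \<in> I" "lam + 3 * eps / 4 \<in> I"
    using eps_pos by (auto simp: field_simps)
  consider "s = lam + eps / 2" | "s < lam + eps / 2" | "s > lam + eps / 2" by linarith
  then show False
  proof cases
    case 1
    then show False using L_eq_on_I[OF I(2)] s by simp
  next
    case 2
    then show False using no[OF I(3) I(2)] eps_pos by simp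
  next
    case 3
    then show False using no[OF I(1) I(2)] eps_pos by simp
  qed
qed

lemma L_eq_on_E: "t \<in> E \<Longrightarrow> L t = ereal (f t)"
  using L_not_MInf[of t] by (cases "L t") (simp_all add: E_def f_def)

lemma f_zero: "f 0 = 0"
  by (simp add: f_def L_zero)

lemma L_convex_on_E:
  assumes "s \<in> E" "t \<in> E" "0 \<le> u" "0 \<le> v" "u + v = 1"
  shows "L (u * s + v * t) \<le> ereal (u * f s + v * f t)"
proof (rule ereal_le_epsilon2)
  fix e :: real assume "0 < e"
  then have "L (u * s + v * t) \<le> ereal (u * (f s + e) + v * (f t + e))"
    using assms by (intro L_convex) (auto simp: L_eq_on_E)
  moreover have "u * (f s + e) + v * (f t + e) = u * f s + v * f t + (u + v) * e"
    by (simp add: algebra_simps)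
  ultimately show "L (u * s + v * t) \<le> ereal (u * f s + v * f t) + ereal e"
    using assms(5) by simp
qed

lemma convex_E: "convex E"
proof (rule convexI)
  fix s t u v :: real
  assume "s \<in> E" "t \<in> E" "0 \<le> u" "0 \<le> v" "u + v = 1"
  from L_convex_on_E[OF this] show "u *\<^sub>R s + v *\<^sub>R t \<in> E"
    by (auto simp: E_def)
qed

lemma f_convex: "convex_on E f"
proof (rule convex_onI[OF _ convex_E])
  fix u s t :: real
  assume *: "0 < u" "u < 1" "s \<in> E" "t \<in> E"
  then have "(1 - u) * s + u * t \<in> E"
    using convexD[OF convex_E, of s t "1 - u" u] by simp
  then show "f ((1 - u) *\<^sub>R s + u *\<^sub>R t) \<le> (1 - u) * f s + u * f t"
    using L_convex_on_E[of s t "1 - u" u] * L_eq_on_E by simp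
qed

text \<open>Finiteness at \<open>0\<close> and on \<open>I\<close> extends by convexity to everything between.\<close>

lemma Ico_subset_E: "{0..<lam + eps} \<subseteq> E"
proof
  fix s assume s: "s \<in> {0..<lam + eps}"
  define t where "t = (max s lam + (lam + eps)) / 2"
  have t: "t \<in> I" "s \<le> t" using s eps_pos by (auto simp: t_def max_def field_simps)
  then have "t \<in> E" by (simp add: E_def L_eq_on_I)
  moreover have "0 \<in> E" by (simp add: E_def L_zero)
  ultimately have "closed_segment 0 t \<subseteq> E" using convex_E by (simp add: convex_contains_segment)
  then show "s \<in> E" using s t by (auto simp: closed_segment_eq_real_ivl)
qed

lemma I_subset_E: "I \<subseteq> E"
  using Ico_subset_E lam_nonneg by auto

text \<open>A convex function lies above its tangents on its whole domain, so a local slope in \<open>I\<close>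
  controls \<open>L\<close> on all of the real line.\<close>

lemma tangent_le:
  assumes t: "t \<in> I"
  shows "ereal (f t + d t * (s - t)) \<le> L s"
proof (cases "s \<in> E")
  case True
  have "t \<in> interior E"
    using interior_maximal[OF I_subset_E] t by auto
  then have "d t * (s - t) \<le> f s - f t"
    using True has_field_derivative_at_within[OF f_has_derivative[OF t]]
    by (intro convex_on_imp_above_tangent[OF f_convex]) (simp_all add: convex_connected convex_E)
  then show ?thesis by (simp add: L_eq_on_E[OF True])
qed (simp add: E_def)

lemma tangent_le_f:
  assumes "t \<in> I" "s \<in> E"
  shows "f t + d t * (s - t) \<le> f s"
  using tangent_le[OF assms(1), of s] by (simp add: L_eq_on_E[OF assms(2)])

lemma d_mono:
  assumes "s \<in> I" "t \<in> I" "s \<le> t"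
  shows "d s \<le> d t"
proof (cases "s = t")
  case False
  have "s \<in> E" "t \<in> E" using assms I_subset_E by blast+
  then have "f s + d s * (t - s) \<le> f t" "f t + d t * (s - t) \<le> f s"
    using assms tangent_le_f by blast+
  then have "0 \<le> (d t - d s) * (t - s)" by (simp add: algebra_simps)
  then show ?thesis using False assms by (simp add: zero_le_mult_iff)
qed simp

text \<open>Darboux's theorem for \<open>d\<close>: the minimum of \<open>f(r) - z r\<close> over \<open>[s,t]\<close> cannot be at an end point.
  Together with monotonicity this replaces continuity of \<open>d\<close> in what follows.\<close>

lemma d_intermediate:
  assumes st: "s \<in> I" "t \<in> I" "s < t" and z: "d s < z" "z < d t"
  obtains p where "s < p" "p < t" "d p = z"
proof -
  define h where "h r = f r - z * r" for r
  have h': "(h has_real_derivative (d r - z)) (at r)" if "r \<in> I" for r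
    unfolding h_def by (auto intro!: derivative_eq_intros f_has_derivative[OF that])
  have sub: "{s..t} \<subseteq> I" using st by auto
  have "continuous_on {s..t} h"
  proof (rule DERIV_continuous_on)
    fix r assume "r \<in> {s..t}"
    then have "r \<in> I" using sub by blast
    then show "(h has_real_derivative (d r - z)) (at r within {s..t})"
      by (rule has_field_derivative_at_within[OF h'])
  qed
  then obtain p where p: "p \<in> {s..t}" and min: "\<And>r. r \<in> {s..t} \<Longrightarrow> h p \<le> h r"
    using continuous_attains_inf[of "{s..t}" h] st by auto
  have "p \<noteq> s"
  proof
    assume "p = s"
    obtain e where e: "e > 0" "\<And>k. 0 < k \<Longrightarrow> k < e \<Longrightarrow> h (s + k) < h s"
      using DERIV_neg_dec_right[OF h'[OF st(1)]] z(1) by auto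
    define k where "k = min (e / 2) (t - s)"
    have "h (s + k) < h s" using e st by (intro e(2)) (auto simp: k_def min_def)
    moreover have "s + k \<in> {s..t}" using e st by (auto simp: k_def min_def)
    ultimately show False using min[of "s + k"] \<open>p = s\<close> by simp
  qed
  moreover have "p \<noteq> t"
  proof
    assume "p = t"
    obtain e where e: "e > 0" "\<And>k. 0 < k \<Longrightarrow> k < e \<Longrightarrow> h (t - k) < h t"
      using DERIV_pos_inc_left[OF h'[OF st(2)]] z(2) by auto
    define k where "k = min (e / 2) (t - s)"
    have "h (t - k) < h t" using e st by (intro e(2)) (auto simp: k_def min_def)
    moreover have "t - k \<in> {s..t}" using e st by (auto simp: k_def min_def)
    ultimately show False using min[of "t - k"] \<open>p = t\<close> by simp
  qed
  ultimately have p': "s < p" "p < t" using p by auto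
  have "d p - z = 0"
  proof (rule DERIV_local_min[OF h'])
    show "p \<in> I" using p sub by auto
    show "0 < min (p - s) (t - p)" using p' by simp
    show "\<forall>y. \<bar>p - y\<bar> < min (p - s) (t - p) \<longrightarrow> h p \<le> h y"
      by (auto intro!: min)
  qed
  with p' show ?thesis by (intro that) simp_all
qed

lemma ereal_deriv_eq: "ereal_deriv L t = ereal (d t)"
  by (simp add: ereal_deriv_def d_def f_def)

lemma left_deriv_eq: "b = (SUP t\<in>I. ereal (d t))"
proof -
  have "(ereal_deriv L \<longlongrightarrow> (SUP t\<in>I. ereal_deriv L t)) (at_left (lam + eps))"
    using eps_pos by (intro mono_tendsto_at_left_SUP) (auto simp: ereal_deriv_eq intro!: d_mono)
  then show ?thesis
    unfolding left_deriv_def by (simp add: tendsto_Lim ereal_deriv_eq)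
qed

text \<open>This is the form in which the assumption on the supremum of the derivatives is used.\<close>

lemma d_less_left_deriv:
  assumes "t \<in> I"
  shows "ereal (d t) < b"
proof -
  have "ereal (d t) \<le> b" unfolding left_deriv_eq using assms by (rule SUP_upper)
  moreover have "ereal (d t) \<noteq> b"
    using not_maximum assms unfolding left_deriv_eq ereal_deriv_eq by (metis imageI)
  ultimately show ?thesis by simp
qed

lemma right_deriv_eq:
  assumes t: "t \<in> I"
  shows "right_deriv L t = ereal (d t)"
proof -
  have "L ((t + (lam + eps)) / 2) = ereal (f ((t + (lam + eps)) / 2))"
    using t by (intro L_eq_on_I) auto
  moreover have "t < (t + (lam + eps)) / 2" using t by simp
  ultimately have fin: "\<not> (\<forall>s>t. L s = \<infinity>)" by (metis PInfty_neq_ereal(1))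
  have "((\<lambda>s. (f s - f t) / (s - t)) \<longlongrightarrow> d t) (at_right t)"
    using f_has_derivative[OF t] unfolding has_field_derivative_iff by (rule filterlim_at_split[THEN iffD1, THEN conjunct2])
  then have "((\<lambda>s. ereal ((f s - f t) / (s - t))) \<longlongrightarrow> ereal (d t)) (at_right t)"
    by simp
  moreover have "\<forall>\<^sub>F s in at_right t. ereal ((f s - f t) / (s - t)) = (L s - L t) / ereal (s - t)"
    unfolding eventually_at_right_field
  proof (intro exI[of _ "lam + eps"] conjI allI impI)
    show "t < lam + eps" using t by simp
    fix s assume "t < s" "s < lam + eps"
    then show "ereal ((f s - f t) / (s - t)) = (L s - L t) / ereal (s - t)"
      using t L_eq_on_I[of s] L_eq_on_I[of t] by simp
  qed
  ultimately have "((\<lambda>s. (L s - L t) / ereal (s - t)) \<longlongrightarrow> ereal (d t)) (at_right t)"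
    by (rule Lim_transform_eventually)
  then show ?thesis
    using fin L_not_MInf unfolding right_deriv_def by (simp add: tendsto_Lim)
qed

lemma slope_tendsto:
  assumes t: "t \<in> {lam..<lam + eps}"
  shows "slope t = (INF s\<in>{t<..<lam + eps}. ereal (d s))"
    and "((\<lambda>s. ereal (d s)) \<longlongrightarrow> slope t) (at_right t)"
proof -
  have lim: "((\<lambda>s. ereal (d s)) \<longlongrightarrow> (INF s\<in>{t<..<lam + eps}. ereal (d s))) (at_right t)"
    using t by (intro mono_tendsto_at_right_INF) (auto intro!: d_mono)
  moreover have "\<forall>\<^sub>F s in at_right t. ereal (d s) = right_deriv L s"
    unfolding eventually_at_right_field
    using t by (intro exI[of _ "lam + eps"]) (auto simp: right_deriv_eq)
  ultimately have "(right_deriv L \<longlongrightarrow> (INF s\<in>{t<..<lam + eps}. ereal (d s))) (at_right t)"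
    by (rule Lim_transform_eventually)
  then show *: "slope t = (INF s\<in>{t<..<lam + eps}. ereal (d s))"
    unfolding right_lim_def by (intro tendsto_Lim) simp_all
  show "((\<lambda>s. ereal (d s)) \<longlongrightarrow> slope t) (at_right t)"
    using lim unfolding * .
qed

lemma slope_le_d: "t \<in> {lam..<lam + eps} \<Longrightarrow> s \<in> I \<Longrightarrow> t < s \<Longrightarrow> slope t \<le> ereal (d s)"
  unfolding slope_tendsto(1) by (rule INF_lower) simp

lemma slope_lessD:
  assumes "t \<in> {lam..<lam + eps}" "slope t < y"
  obtains s where "s \<in> I" "t < s" "ereal (d s) < y"
  using assms unfolding slope_tendsto(1)[OF assms(1)] by (auto simp: INF_less_iff)

text \<open>A jump of \<open>d\<close> at \<open>t\<close> would leave out slopes that the intermediate value property provides.\<close>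

lemma slope_eq_d:
  assumes t: "t \<in> I"
  shows "slope t = ereal (d t)"
proof (rule antisym)
  have t': "t \<in> {lam..<lam + eps}" using t by simp
  show "ereal (d t) \<le> slope t"
    unfolding slope_tendsto(1)[OF t'] using t by (auto intro!: INF_greatest d_mono)
  show "slope t \<le> ereal (d t)"
  proof (rule ccontr)
    assume "\<not> slope t \<le> ereal (d t)"
    then obtain z where z: "ereal (d t) < z" "z < slope t" using dense by (auto simp: not_le)
    have u: "(t + (lam + eps)) / 2 \<in> I" "t < (t + (lam + eps)) / 2" using t by auto
    from z obtain r where r: "z = ereal r" using slope_le_d[OF t' u] by (cases z) auto
    have "r < d ((t + (lam + eps)) / 2)"
      using z(2) slope_le_d[OF t' u] unfolding r by (meson ereal_less(1) less_le_trans less_ereal.simps(1))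
    then obtain p where p: "t < p" "p < (t + (lam + eps)) / 2" "d p = r"
      using d_intermediate[OF t u, of r] z(1) r by auto
    then have "slope t \<le> z" using slope_le_d[OF t', of p] t unfolding r by auto
    then show False using z(2) by simp
  qed
qed

text \<open>Subtracting the tangent slope at a point \<open>t0\<close> to the right of \<open>t\<close> makes \<open>f\<close> decreasing on
  \<open>]t,t0[\<close>, so that the limit at \<open>t\<close> exists; convexity and \<open>f(0) = 0\<close> bound it from above.
  When \<open>t = 0\<close> the limit may differ from \<open>L(0)\<close>.\<close>

lemma right_lim_real:
  assumes t: "t \<in> {lam..<lam + eps}"
  obtains R where "right_lim L t = ereal R" "(f \<longlongrightarrow> R) (at_right t)"
proof -
  define t0 where "t0 = (t + (lam + eps)) / 2"
  have t0: "t0 \<in> I" "t < t0" "t \<ge> 0" using t lam_nonneg by (auto simp: t0_def)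
  define h where "h s = f s - d t0 * s" for s
  have anti: "h s \<le> h r" if "t < r" "r \<le> s" "s < t0" for r s
  proof -
    have s: "s \<in> I" and r: "r \<in> I" using that t t0 by auto
    have "f s + d s * (r - s) \<le> f r" using tangent_le_f[OF s] r I_subset_E by auto
    moreover have "d t0 * (s - r) \<ge> d s * (s - r)"
      using d_mono[OF s t0(1)] that by (intro mult_right_mono) auto
    ultimately show ?thesis by (simp add: h_def algebra_simps)
  qed
  define S where "S = (SUP s\<in>{t<..<t0}. ereal (h s))"
  have lim: "((\<lambda>s. ereal (h s)) \<longlongrightarrow> S) (at_right t)"
    unfolding S_def using t0 anti by (intro antimono_tendsto_at_right_SUP) auto
  have "ereal (h ((t + t0) / 2)) \<le> S"
    unfolding S_def using t0(2) by (intro SUP_upper) auto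
  moreover have "S \<le> ereal (\<bar>f t0\<bar> + \<bar>d t0\<bar> * t0)"
    unfolding S_def
  proof (rule SUP_least)
    fix s assume s: "s \<in> {t<..<t0}"
    have "0 \<in> E" "t0 \<in> E" "s \<in> E" using Ico_subset_E s t t0 lam_nonneg by auto
    then have "f s \<le> s / t0 * f t0"
      using L_convex_on_E[of 0 t0 "1 - s / t0" "s / t0"] s t0 by (simp add: f_zero L_eq_on_E)
    also have "\<dots> \<le> s / t0 * \<bar>f t0\<bar>" using s t0 by (intro mult_left_mono) auto
    also have "\<dots> \<le> 1 * \<bar>f t0\<bar>" using s t0 by (intro mult_right_mono) auto
    finally have "f s \<le> \<bar>f t0\<bar>" by simp
    moreover have "- (d t0 * s) \<le> \<bar>d t0\<bar> * t0"
    proof -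
      have "- (d t0 * s) \<le> \<bar>d t0\<bar> * s"
        using s t0 by (metis abs_ge_minus_self minus_mult_left mult_right_mono greaterThanLessThan_iff le_less_trans less_imp_le)
      also have "\<dots> \<le> \<bar>d t0\<bar> * t0" using s by (intro mult_left_mono) auto
      finally show ?thesis .
    qed
    ultimately show "ereal (h s) \<le> ereal (\<bar>f t0\<bar> + \<bar>d t0\<bar> * t0)" by (simp add: h_def)
  qed
  ultimately obtain H where H: "S = ereal H" by (cases S) auto
  have "(h \<longlongrightarrow> H) (at_right t)" using lim unfolding H by simp
  then have "((\<lambda>s. h s + d t0 * s) \<longlongrightarrow> H + d t0 * t) (at_right t)"
    by (intro tendsto_intros)
  then have f: "(f \<longlongrightarrow> H + d t0 * t) (at_right t)" by (simp add: h_def)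
  then have "((\<lambda>s. ereal (f s)) \<longlongrightarrow> ereal (H + d t0 * t)) (at_right t)" by simp
  moreover have "\<forall>\<^sub>F s in at_right t. ereal (f s) = L s"
    unfolding eventually_at_right_field
    using t by (intro exI[of _ "lam + eps"]) (auto simp: L_eq_on_I)
  ultimately have "(L \<longlongrightarrow> ereal (H + d t0 * t)) (at_right t)"
    by (rule Lim_transform_eventually)
  then have "right_lim L t = ereal (H + d t0 * t)"
    unfolding right_lim_def by (intro tendsto_Lim) simp_all
  then show ?thesis using f by (rule that)
qed

text \<open>The gap of size \<open>2 \<delta>\<close> leaves one \<open>\<delta>\<close> for lowering the value at \<open>s\<close> and one for the gain
  \<open>\<eta>\<close> in the tilting estimate.\<close>

lemma slope_gap:
  assumes s: "s \<in> I" and "w0 < d s" "d s < w1"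
  obtains \<theta> \<delta> where "\<theta> > 0" "\<delta> > 0"
    "L (s + \<theta>) < ereal (f s - 2 * \<delta> + \<theta> * w1)" "L (s - \<theta>) < ereal (f s - 2 * \<delta> - \<theta> * w0)"
proof -
  have "((\<lambda>r. f r - w1 * r) has_real_derivative d s - w1) (at s)"
    by (auto intro!: derivative_eq_intros f_has_derivative[OF s])
  then obtain e1 where e1: "e1 > 0" "\<And>h. 0 < h \<Longrightarrow> h < e1 \<Longrightarrow> f (s + h) - w1 * (s + h) < f s - w1 * s"
    using DERIV_neg_dec_right[of "\<lambda>r. f r - w1 * r"] assms(3) by force
  have "((\<lambda>r. f r - w0 * r) has_real_derivative d s - w0) (at s)"
    by (auto intro!: derivative_eq_intros f_has_derivative[OF s])
  then obtain e0 where e0: "e0 > 0" "\<And>h. 0 < h \<Longrightarrow> h < e0 \<Longrightarrow> f (s - h) - w0 * (s - h) < f s - w0 * s"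
    using DERIV_pos_inc_left[of "\<lambda>r. f r - w0 * r"] assms(2) by force
  define \<theta> where "\<theta> = min (min e0 e1) (min (s - lam) (lam + eps - s)) / 2"
  have \<theta>: "0 < \<theta>" "\<theta> < e0" "\<theta> < e1" "s + \<theta> \<in> I" "s - \<theta> \<in> I"
    using e0(1) e1(1) s by (auto simp: \<theta>_def min_def field_simps)
  define \<delta> where "\<delta> = min (f s + \<theta> * w1 - f (s + \<theta>)) (f s - \<theta> * w0 - f (s - \<theta>)) / 3"
  have "f (s + \<theta>) < f s + \<theta> * w1" "f (s - \<theta>) < f s - \<theta> * w0"
    using e1(2)[OF \<theta>(1,3)] e0(2)[OF \<theta>(1,2)] by (simp_all add: algebra_simps)
  then have \<delta>: "\<delta> > 0" "f (s + \<theta>) < f s - 2 * \<delta> + \<theta> * w1" "f (s - \<theta>) < f s - 2 * \<delta> - \<theta> * w0"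
  proof -
    assume gaps: "f (s + \<theta>) < f s + \<theta> * w1" "f (s - \<theta>) < f s - \<theta> * w0"
    then show "\<delta> > 0" by (simp add: \<delta>_def)
    moreover have "3 * \<delta> \<le> f s + \<theta> * w1 - f (s + \<theta>)" "3 * \<delta> \<le> f s - \<theta> * w0 - f (s - \<theta>)"
      by (simp_all add: \<delta>_def)
    ultimately show "f (s + \<theta>) < f s - 2 * \<delta> + \<theta> * w1" "f (s - \<theta>) < f s - 2 * \<delta> - \<theta> * w0"
      by linarith+
  qed
  then show ?thesis using that[OF \<theta>(1) \<delta>(1)] \<theta> by (simp add: L_eq_on_I)
qed

section \<open>The concave transform\<close>

text \<open>The tangents at points \<open>r\<close> of \<open>I\<close> pass below \<open>(0, L 0)\<close>, that is \<open>f(r) \<le> r d(r)\<close>, where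
  \<open>r > lam > 0\<close> and \<open>f(r)\<close> stays bounded as \<open>r\<close> decreases to \<open>lam\<close>.\<close>

lemma slope_lam_not_MInf:
  assumes "lam > 0"
  shows "a \<noteq> -\<infinity>"
proof
  assume a: "a = -\<infinity>"
  have lam: "lam \<in> {lam..<lam + eps}" using eps_pos by simp
  obtain R where R: "(f \<longlongrightarrow> R) (at_right lam)" using right_lim_real[OF lam] .
  \<comment> \<open>A tangent of slope below \<open>-K\<close> at a point near \<open>lam\<close> is positive at \<open>0\<close>.\<close>
  define K where "K = (\<bar>R\<bar> + 1) / lam"
  have K: "0 < K" "lam * K = \<bar>R\<bar> + 1" using assms by (auto simp: K_def intro: divide_pos_pos)
  have "\<forall>\<^sub>F r in at_right lam. R - 1 < f r" using order_tendstoD(1)[OF R] by simp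
  moreover have "\<forall>\<^sub>F r in at_right lam. ereal (d r) < ereal (- K)"
  proof -
    have "a < ereal (- K)" using a by simp
    then show ?thesis by (rule order_tendstoD(2)[OF slope_tendsto(2)[OF lam]])
  qed
  moreover have "\<forall>\<^sub>F r in at_right lam. r \<in> I"
    unfolding eventually_at_right_field using eps_pos by (intro exI[of _ "lam + eps"]) auto
  ultimately have "\<forall>\<^sub>F r in at_right lam. False"
  proof eventually_elim
    case (elim r)
    have "lam * K \<le> r * K" using elim(3) K(1) by (intro mult_right_mono) auto
    also have "\<dots> \<le> r * (- d r)" using elim assms by (intro mult_left_mono) auto
    finally have "\<bar>R\<bar> + 1 \<le> - (r * d r)" using K by simp
    moreover have "f r + d r * (0 - r) \<le> f 0"
      by (rule tangent_le_f[OF elim(3)]) (simp add: E_def L_zero)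
    ultimately show False using elim(1) by (simp add: f_zero mult.commute)
  qed
  then show False by simp
qed

text \<open>Both parts pass to the limit \<open>r \<rightarrow> t+\<close>, the first in the tangents at \<open>r\<close>.  The right limit of
  \<open>L\<close> takes the place of \<open>L t\<close>, because \<open>L\<close> may jump at the end point \<open>t = lam = 0\<close>.\<close>

lemma right_tangent:
  assumes t: "t \<in> {lam..<lam + eps}" and z: "slope t = ereal z" and R: "right_lim L t = ereal R"
  shows "ereal (R - t * z + s * z) \<le> L s"
    and "e > 0 \<Longrightarrow> \<exists>r\<in>I. t < r \<and> f r - r * z < R - t * z + e"
proof -
  obtain R' where R': "right_lim L t = ereal R'" "(f \<longlongrightarrow> R') (at_right t)"
    using right_lim_real[OF t] .
  have f: "(f \<longlongrightarrow> R) (at_right t)" using R' R by simp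
  have d: "(d \<longlongrightarrow> z) (at_right t)" using slope_tendsto(2)[OF t] unfolding z by simp
  have I: "\<forall>\<^sub>F r in at_right t. r \<in> I \<and> t < r"
    unfolding eventually_at_right_field using t by (intro exI[of _ "lam + eps"]) auto
  have "((\<lambda>r. f r + d r * (s - r)) \<longlongrightarrow> R + z * (s - t)) (at_right t)"
    by (intro tendsto_intros f d)
  then have "((\<lambda>r. ereal (f r + d r * (s - r))) \<longlongrightarrow> ereal (R + z * (s - t))) (at_right t)"
    by simp
  moreover have "\<forall>\<^sub>F r in at_right t. ereal (f r + d r * (s - r)) \<le> L s"
    using I by eventually_elim (auto intro: tangent_le)
  ultimately have "ereal (R + z * (s - t)) \<le> L s"
    by (rule tendsto_upperbound) simp
  then show "ereal (R - t * z + s * z) \<le> L s" by (simp add: algebra_simps)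
  show "\<exists>r\<in>I. t < r \<and> f r - r * z < R - t * z + e" if "e > 0"
  proof -
    have "((\<lambda>r. f r - r * z) \<longlongrightarrow> R - t * z) (at_right t)"
      by (intro tendsto_intros f)
    then have "\<forall>\<^sub>F r in at_right t. f r - r * z < R - t * z + e"
      using that by (intro order_tendstoD(2)) auto
    with I have "\<forall>\<^sub>F r in at_right t. r \<in> I \<and> t < r \<and> f r - r * z < R - t * z + e"
      by eventually_elim auto
    then have "\<exists>r. r \<in> I \<and> t < r \<and> f r - r * z < R - t * z + e"
      by (intro eventually_happens') simp_all
    then show ?thesis by blast
  qed
qed

text \<open>The negative Legendre-Fenchel transform on \<open>[a,b[\<close>.  At \<open>-\<infinity>\<close> the infimum would not be its limit,
  which is \<open>0\<close> whenever \<open>a = -\<infinity>\<close>.\<close>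

definition G :: "ereal \<Rightarrow> ereal" where
  "G z = (if z = -\<infinity> then 0 else (INF s\<in>{0<..}. L s - ereal s * z))"

definition w :: "real \<Rightarrow> real" where
  "w r = real_of_ereal (G (ereal r))"

text \<open>In particular the value on the right depends on \<open>z\<close> only, and not on the choice of \<open>t\<close>.\<close>

lemma G_eq_right_value:
  assumes t: "t \<in> {lam..<lam + eps}" and z: "slope t = ereal z" and R: "right_lim L t = ereal R"
  shows "G (ereal z) = ereal (R - t * z)"
proof -
  have "(INF s\<in>{0<..}. L s - ereal s * ereal z) = ereal (R - t * z)"
  proof (rule antisym)
    show "(INF s\<in>{0<..}. L s - ereal s * ereal z) \<le> ereal (R - t * z)"
    proof (rule ereal_le_epsilon2)
      fix e :: real assume "0 < e"
      then obtain r where r: "r \<in> I" "f r - r * z < R - t * z + e"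
        using right_tangent(2)[OF assms] by blast
      have "(INF s\<in>{0<..}. L s - ereal s * ereal z) \<le> L r - ereal r * ereal z"
        using r(1) lam_nonneg by (intro INF_lower) auto
      also have "\<dots> = ereal (f r - r * z)" by (simp add: L_eq_on_I[OF r(1)])
      also have "\<dots> \<le> ereal (R - t * z) + ereal e" using r(2) by simp
      finally show "(INF s\<in>{0<..}. L s - ereal s * ereal z) \<le> ereal (R - t * z) + ereal e" .
    qed
    show "ereal (R - t * z) \<le> (INF s\<in>{0<..}. L s - ereal s * ereal z)"
    proof (rule INF_greatest)
      fix s
      show "ereal (R - t * z) \<le> L s - ereal s * ereal z"
        using right_tangent(1)[OF assms, of s] by (cases "L s") auto
    qed
  qed
  then show ?thesis by (simp add: G_def)
qed

lemma slope_less_left_deriv: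
  assumes t: "t \<in> {lam..<lam + eps}"
  shows "slope t < b"
proof -
  have s: "(t + (lam + eps)) / 2 \<in> I" "t < (t + (lam + eps)) / 2" using t by auto
  show ?thesis using slope_le_d[OF t s] d_less_left_deriv[OF s(1)] by (rule le_less_trans)
qed

lemma d_attains:
  assumes "a < ereal r" "ereal r < b"
  obtains t where "t \<in> I" "d t = r"
proof -
  have lam: "lam \<in> {lam..<lam + eps}" using eps_pos by simp
  obtain s1 where s1: "s1 \<in> I" "d s1 < r" using slope_lessD[OF lam assms(1)] by auto
  obtain s2 where s2: "s2 \<in> I" "r < d s2"
    using assms(2) unfolding left_deriv_eq by (auto simp: less_SUP_iff)
  have "s1 < s2" using d_mono[OF s2(1) s1(1)] s1 s2 by linarith
  then obtain p where "s1 < p" "p < s2" "d p = r"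
    using d_intermediate[OF s1(1) s2(1), of r] s1 s2 by auto
  then show ?thesis using s1 s2 by (intro that[of p]) auto
qed

lemma slope_attains:
  assumes "z \<in> {a..<b}"
  shows "\<exists>t\<in>{lam..<lam + eps}. slope t = z"
proof (cases "z = a")
  case True
  then show ?thesis using eps_pos by (intro bexI[of _ lam]) auto
next
  case False
  then have z: "a < z" "z < b" using assms by auto
  then obtain r where r: "z = ereal r" by (cases z) auto
  then obtain t where "t \<in> I" "d t = r" using d_attains z by auto
  then show ?thesis using r slope_eq_d[of t] by (intro bexI[of _ t]) auto
qed

text \<open>Slopes accumulate at every \<open>z\<close> in \<open>[a,b[\<close> from the right; this is where \<open>z < b\<close> enters.\<close>

lemma d_attains_between:
  assumes "a \<le> z" "z < b" "z < y"
  obtains s where "s \<in> I" "z < ereal (d s)" "ereal (d s) < y"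
proof -
  have "z < min y b" using assms by simp
  then obtain x where x: "z < x" "x < min y b" using dense by blast
  then obtain r where r: "x = ereal r" by (cases x) auto
  have "a < ereal r" using assms(1) x(1) unfolding r by (rule le_less_trans)
  then obtain s where "s \<in> I" "d s = r" using d_attains[of r] x(2) r by auto
  then show ?thesis using x r by (intro that[of s]) auto
qed

text \<open>The slope \<open>-\<infinity>\<close> occurs only at \<open>lam = 0\<close>, the case for which right continuity is assumed.\<close>

lemma slope_MInf:
  assumes t: "t \<in> {lam..<lam + eps}" and "slope t = -\<infinity>"
  shows "lam = 0" "t = 0" "a = -\<infinity>" "right_lim L 0 = 0"
proof -
  have "t \<notin> I" using slope_eq_d[of t] assms(2) by auto
  then have "t = lam" using t by auto
  then show a: "a = -\<infinity>" using assms(2) by simp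
  then show lam: "lam = 0" using slope_lam_not_MInf lam_nonneg by force
  then show "t = 0" using \<open>t = lam\<close> by simp
  have "(L \<longlongrightarrow> L 0) (at_right 0)"
    using right_continuous[OF lam] a lam by (simp add: continuous_within)
  then show "right_lim L 0 = 0"
    unfolding right_lim_def L_zero by (intro tendsto_Lim) simp_all
qed

lemma right_value_eq_G:
  assumes t: "t \<in> {lam..<lam + eps}" and z: "slope t = z"
  shows "right_lim L t - ereal t * z = G z"
proof (cases "z = -\<infinity>")
  case True
  then show ?thesis using slope_MInf[OF t] z by (simp add: G_def)
next
  case False
  obtain R where R: "right_lim L t = ereal R" using right_lim_real[OF t] .
  obtain r where r: "z = ereal r"
    using False slope_less_left_deriv[OF t] z by (cases z) auto
  show ?thesis
    using G_eq_right_value[OF t _ R, of r] z r R by simp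
qed

lemma w_properties:
  assumes "a \<le> ereal r" "ereal r < b"
  shows "G (ereal r) = ereal (w r)"
    and "ereal (w r + s * r) \<le> L s"
    and "e > 0 \<Longrightarrow> \<exists>s\<in>I. f s - s * r < w r + e"
proof -
  obtain t where t: "t \<in> {lam..<lam + eps}" "slope t = ereal r"
    using slope_attains[of "ereal r"] assms by auto
  obtain R where R: "right_lim L t = ereal R" using right_lim_real[OF t(1)] .
  note G = G_eq_right_value[OF t R]
  then have w: "w r = R - t * r" by (simp add: w_def)
  then show "G (ereal r) = ereal (w r)" using G by simp
  show "ereal (w r + s * r) \<le> L s" using right_tangent(1)[OF t R] unfolding w .
  show "\<exists>s\<in>I. f s - s * r < w r + e" if "e > 0"
    using right_tangent(2)[OF t R that] unfolding w by blast
qed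

lemma w_le:
  assumes "a \<le> ereal r" "ereal r < b" "s \<in> I"
  shows "w r \<le> f s - s * r"
  using w_properties(2)[OF assms(1,2), of s] by (simp add: L_eq_on_I[OF assms(3)])

lemma a_le_d: "t \<in> I \<Longrightarrow> a \<le> ereal (d t)"
  using slope_le_d[of lam t] by simp

lemma w_d:
  assumes t: "t \<in> I"
  shows "w (d t) = f t - t * d t"
proof (rule antisym)
  show "w (d t) \<le> f t - t * d t"
    using w_le[OF a_le_d d_less_left_deriv t] t by simp
  show "f t - t * d t \<le> w (d t)"
  proof (rule field_le_epsilon)
    fix e :: real assume "0 < e"
    then obtain s where s: "s \<in> I" "f s - s * d t < w (d t) + e"
      using w_properties(3)[OF a_le_d[OF t] d_less_left_deriv[OF t]] by blast
    moreover have "f t + d t * (s - t) \<le> f s" using tangent_le_f[OF t] s I_subset_E by blast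
    ultimately show "f t - t * d t \<le> w (d t) + e" by (simp add: algebra_simps)
  qed
qed

lemma legendre_eq_G:
  assumes "z \<in> {a..<b}"
  shows "legendre L z = - G z"
proof (cases "z = -\<infinity>")
  case True
  then have "slope lam = -\<infinity>" using assms by auto
  then show ?thesis using slope_MInf(4)[of lam] eps_pos True by (simp add: legendre_def G_def)
next
  case False
  then obtain r where r: "z = ereal r" using assms by (cases z) auto
  then have ab: "a \<le> ereal r" "ereal r < b" using assms by auto
  have "(SUP t. ereal t * ereal r - L t) = ereal (- w r)"
  proof (rule antisym)
    show "(SUP t. ereal t * ereal r - L t) \<le> ereal (- w r)"
    proof (rule SUP_least)
      fix s show "ereal s * ereal r - L s \<le> ereal (- w r)"
        using w_properties(2)[OF ab, of s] by (cases "L s") auto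
    qed
    show "ereal (- w r) \<le> (SUP t. ereal t * ereal r - L t)"
    proof (rule ereal_le_epsilon2)
      fix e :: real assume "0 < e"
      then obtain s where s: "s \<in> I" "f s - s * r < w r + e" using w_properties(3)[OF ab] by blast
      then have "ereal (- w r) \<le> (ereal s * ereal r - L s) + ereal e"
        by (simp add: L_eq_on_I)
      also have "\<dots> \<le> (SUP t. ereal t * ereal r - L t) + ereal e"
        by (intro add_right_mono SUP_upper) simp
      finally show "ereal (- w r) \<le> (SUP t. ereal t * ereal r - L t) + ereal e" .
    qed
  qed
  then show ?thesis using r w_properties(1)[OF ab] by (simp add: legendre_def)
qed

lemma G_bounds:
  assumes "z \<in> {a..<b}"
  shows "-\<infinity> < G z" "G z \<le> 0"
proof -
  have "-\<infinity> < G z \<and> G z \<le> 0"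
  proof (cases "z = -\<infinity>")
    case False
    then obtain r where r: "z = ereal r" using assms by (cases z) auto
    then have ab: "a \<le> ereal r" "ereal r < b" using assms by auto
    show ?thesis using w_properties(1)[OF ab] w_properties(2)[OF ab, of 0] r by (simp add: L_zero)
  qed (simp add: G_def)
  then show "-\<infinity> < G z" "G z \<le> 0" by auto
qed

text \<open>For real \<open>z\<close>, concavity of \<open>G\<close> on a segment that starts at \<open>z\<close> bounds it from below just to the
  right of \<open>z\<close>.  For \<open>z = -\<infinity>\<close> slopes near \<open>z\<close> belong to points near \<open>0\<close>, where \<open>f\<close> is near \<open>0\<close> and
  \<open>- s d(s)\<close> is positive.\<close>

lemma G_lower_right:
  assumes z: "z \<in> {a..<b}" and l: "l < G z"
  obtains y where "z < y" "\<And>s. s \<in> I \<Longrightarrow> z < ereal (d s) \<Longrightarrow> ereal (d s) < y \<Longrightarrow> l < ereal (f s - s * d s)"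
proof (cases "z = -\<infinity>")
  case True
  then have sl: "slope lam = -\<infinity>" using z by auto
  have lam: "lam \<in> {lam..<lam + eps}" using eps_pos by simp
  have R: "lam = 0" "right_lim L 0 = 0" using slope_MInf[OF lam sl] by auto
  obtain R' where R': "right_lim L 0 = ereal R'" "(f \<longlongrightarrow> R') (at_right 0)"
    using right_lim_real[OF lam] R by auto
  then have f0: "((\<lambda>s. ereal (f s)) \<longlongrightarrow> 0) (at_right 0)"
  proof -
    have "R' = 0" using R R'(1) by simp
    then show ?thesis using tendsto_ereal[OF R'(2)] by (simp only: zero_ereal_def)
  qed
  have "l < 0" using l True by (simp add: G_def)
  then have "\<forall>\<^sub>F s in at_right 0. l < ereal (f s)" using order_tendstoD(1)[OF f0] by simp
  then obtain s0 where s0: "s0 > 0" "\<And>s. 0 < s \<Longrightarrow> s < s0 \<Longrightarrow> l < ereal (f s)"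
    unfolding eventually_at_right_field by auto
  define s1 where "s1 = min (s0 / 2) (eps / 2)"
  have s1: "s1 \<in> I" "s1 < s0" using s0 eps_pos R by (auto simp: s1_def min_def)
  show ?thesis
  proof (rule that[of "ereal (min 0 (d s1))"])
    show "z < ereal (min 0 (d s1))" using True by simp
    fix s assume s: "s \<in> I" and "ereal (d s) < ereal (min 0 (d s1))"
    then have "d s < 0" "d s < d s1" by auto
    then have "s < s1" using d_mono[OF s1(1) s] by linarith
    have "s > 0" using s R by simp
    have "l < ereal (f s)" using s0(2) \<open>s > 0\<close> \<open>s < s1\<close> s1 by simp
    also have "\<dots> \<le> ereal (f s - s * d s)" using \<open>s > 0\<close> \<open>d s < 0\<close> by (simp add: mult_le_0_iff)
    finally show "l < ereal (f s - s * d s)" .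
  qed
next
  case False
  then obtain r where r: "z = ereal r" using z by (cases z) auto
  then have ab: "a \<le> ereal r" "ereal r < b" using z by auto
  obtain s' where s': "s' \<in> I" "ereal r < ereal (d s')"
    using d_attains_between[OF ab ab(2)] by blast
  define q where "q = d s'"
  have rq: "r < q" using s' by (simp add: q_def)
  have qb: "a \<le> ereal q" "ereal q < b" using a_le_d d_less_left_deriv s' by (auto simp: q_def)
  obtain l' where l': "l \<le> ereal l'" "l' < w r"
  proof (cases l)
    case (real x)
    then show ?thesis using l r w_properties(1)[OF ab] by (intro that[of x]) auto
  next
    case PInf
    then show ?thesis using l by simp
  next
    case MInf
    then show ?thesis by (intro that[of "w r - 1"]) auto
  qed
  define K where "K = \<bar>w r - w q\<bar> + 1"
  \<comment> \<open>\<open>h\<close> makes the weight \<open>\<theta>\<close> of \<open>q\<close> less than 1 and its effect on \<open>w\<close> less than \<open>w r - l'\<close>.\<close>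
  define h where "h = min (q - r) ((q - r) * (w r - l') / K)"
  have K: "K > 0" "w r - w q < K" by (auto simp: K_def)
  have h: "h > 0" using K l' rq by (simp add: h_def)
  show ?thesis
  proof (rule that[of "ereal (r + h)"])
    show "z < ereal (r + h)" using h r by simp
    fix s assume s: "s \<in> I" "z < ereal (d s)" "ereal (d s) < ereal (r + h)"
    define \<theta> where "\<theta> = (d s - r) / (q - r)"
    have ds: "r < d s" "d s < r + h" using s r by auto
    have \<theta>: "0 < \<theta>" "\<theta> < 1" "\<theta> * K < w r - l'"
    proof -
      show "0 < \<theta>" using ds rq by (simp add: \<theta>_def)
      show "\<theta> < 1" using ds rq by (simp add: \<theta>_def h_def)
      have "d s - r < (q - r) * (w r - l') / K" using ds by (simp add: h_def)
      then show "\<theta> * K < w r - l'" using rq K by (simp add: \<theta>_def field_simps)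
    qed
    have deq: "d s = (1 - \<theta>) * r + \<theta> * q"
    proof -
      have "\<theta> * (q - r) = d s - r" using rq by (simp add: \<theta>_def)
      then show ?thesis by (simp add: algebra_simps)
    qed
    have "(1 - \<theta>) * w r + \<theta> * w q \<le> (1 - \<theta>) * (f s - s * r) + \<theta> * (f s - s * q)"
      using \<theta> w_le[OF ab s(1)] w_le[OF qb s(1)] by (intro add_mono mult_left_mono) auto
    also have "\<dots> = f s - s * d s" unfolding deq by (simp add: algebra_simps)
    finally have "w r - \<theta> * (w r - w q) \<le> f s - s * d s" by (simp add: algebra_simps)
    moreover have "\<theta> * (w r - w q) \<le> \<theta> * K" using \<theta> K by (intro mult_left_mono) auto
    ultimately have "l' < f s - s * d s" using \<theta>(3) by linarith
    then show "l < ereal (f s - s * d s)" using l'(1) by (simp add: le_less_trans)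
  qed
qed

text \<open>Between \<open>z1\<close> and \<open>z2\<close> lies the slope at some \<open>s > 0\<close>, where the infimum for this slope is
  attained.  Since \<open>s > 0\<close>, the affine function of \<open>z\<close> given by this \<open>s\<close> is strictly decreasing;
  \<open>s = 0\<close>, which could serve \<open>z1\<close> itself, would only give a weak inequality.\<close>

lemma G_strict_antimono:
  assumes z: "z1 \<in> {a..<b}" "z2 \<in> {a..<b}" "z1 < z2"
  shows "G z2 < G z1"
proof -
  obtain s where s: "s \<in> I" "z1 < ereal (d s)" "ereal (d s) < z2"
    using d_attains_between[of z1 z2] z by auto
  then obtain r2 where r2: "z2 = ereal r2" using z by (cases z2) auto
  have ab2: "a \<le> ereal r2" "ereal r2 < b" using z r2 by auto
  have "s > 0" using s lam_nonneg by auto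
  have "w r2 \<le> f s - s * r2" using w_le[OF ab2 s(1)] .
  also have "\<dots> < f s - s * d s" using \<open>s > 0\<close> s r2 by simp
  finally have "G z2 < ereal (w (d s))"
    using w_properties(1)[OF ab2] r2 w_d[OF s(1)] by simp
  also have "\<dots> \<le> G z1"
  proof (cases "z1 = -\<infinity>")
    case True
    then show ?thesis
      using G_bounds(2)[of "ereal (d s)"] w_properties(1)[OF a_le_d d_less_left_deriv] s(1)
        a_le_d d_less_left_deriv by (auto simp: G_def)
  next
    case False
    then obtain r1 where r1: "z1 = ereal r1" using z by (cases z1) auto
    have ab1: "a \<le> ereal r1" "ereal r1 < b" using z r1 by auto
    have "w (d s) \<le> w r1"
    proof (rule field_le_epsilon)
      fix e :: real assume "0 < e"
      then obtain t where t: "t \<in> I" "f t - t * r1 < w r1 + e"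
        using w_properties(3)[OF ab1] by blast
      have "t > 0" using t lam_nonneg by auto
      have "w (d s) \<le> f t - t * d s" using w_le[OF a_le_d d_less_left_deriv t(1)] s(1) by blast
      also have "\<dots> \<le> f t - t * r1" using \<open>t > 0\<close> s(2) r1 by simp
      finally show "w (d s) \<le> w r1 + e" using t(2) by simp
    qed
    then show ?thesis using w_properties(1)[OF ab1] r1 by simp
  qed
  finally show ?thesis .
qed

text \<open>Lower semicontinuity from the right is \<open>G_lower_right\<close>, and upper semicontinuity from the left
  holds because \<open>G\<close> lies below the affine function that touches it at \<open>z\<close>.  The other two
  directions are monotonicity.\<close>

lemma G_continuous: "continuous_on {a..<b} G"
  unfolding continuous_on_def
proof
  fix z assume z: "z \<in> {a..<b}"
  have in_S: "\<forall>\<^sub>F x in at z within {a..<b}. x \<in> {a..<b}"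
    by (simp add: eventually_at_filter)
  have id: "((\<lambda>x. x) \<longlongrightarrow> z) (at z within {a..<b})" by (rule tendsto_ident_at)
  show "(G \<longlongrightarrow> G z) (at z within {a..<b})"
  proof (rule order_tendstoI)
    fix l assume l: "l < G z"
    obtain y where y: "z < y" "\<And>s. s \<in> I \<Longrightarrow> z < ereal (d s) \<Longrightarrow> ereal (d s) < y \<Longrightarrow> l < ereal (f s - s * d s)"
      using G_lower_right[OF z l] by blast
    show "\<forall>\<^sub>F x in at z within {a..<b}. l < G x"
      using in_S order_tendstoD(2)[OF id y(1)]
    proof eventually_elim
      case (elim x)
      consider "x < z" | "x = z" | "z < x" by (rule linorder_cases)
      then show ?case
      proof cases
        case 1
        then show ?thesis using G_strict_antimono[of x z] elim z l by (auto intro: less_trans)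
      next
        case 2
        then show ?thesis using l by simp
      next
        case 3
        then obtain r where r: "x = ereal r" using elim by (cases x) auto
        have "a < ereal r" using z 3 r by (auto intro: le_less_trans)
        then obtain s where s: "s \<in> I" "d s = r" using d_attains[of r] elim r by auto
        have "G x = ereal (f s - s * d s)"
          using w_properties(1)[OF a_le_d d_less_left_deriv] w_d s r by auto
        then show ?thesis using y(2)[OF s(1)] 3 elim s r by simp
      qed
    qed
  next
    fix u assume u: "G z < u"
    show "\<forall>\<^sub>F x in at z within {a..<b}. G x < u"
    proof (cases "z = a")
      case True
      show ?thesis using in_S
      proof eventually_elim
        case (elim x)
        show ?case
        proof (cases "x = z")
          case False
          then have "z < x" using elim True by auto
          then show ?thesis using G_strict_antimono[OF z elim] u by (blast intro: less_trans)
        qed (use u in simp)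
      qed
    next
      case False
      then have az: "a < z" "z < b" using z by auto
      then obtain r where r: "z = ereal r" by (cases z) auto
      obtain t where t: "t \<in> I" "d t = r" using d_attains[of r] az r by auto
      have "t > 0" using t lam_nonneg by auto
      have Gz: "G z = ereal (f t - t * r)"
        using w_properties(1)[OF a_le_d d_less_left_deriv] w_d t r by auto
      obtain u' where u': "ereal u' \<le> u" "f t - t * r < u'"
      proof (cases u)
        case (real v)
        then show ?thesis using u Gz by (intro that[of v]) auto
      next
        case PInf
        then show ?thesis by (intro that[of "f t - t * r + 1"]) auto
      next
        case MInf
        then show ?thesis using u by simp
      qed
      define x0 where "x0 = (f t - u') / t"
      have "x0 < r" using u' \<open>t > 0\<close> by (simp add: x0_def field_simps)
      then have "ereal x0 < z" using r by simp
      show ?thesis using in_S order_tendstoD(1)[OF id \<open>ereal x0 < z\<close>]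
      proof eventually_elim
        case (elim x)
        then obtain q where q: "x = ereal q" by (cases x) auto
        have ab: "a \<le> ereal q" "ereal q < b" using elim q by auto
        have "w q \<le> f t - t * q" using w_le[OF ab t(1)] .
        also have "\<dots> < u'" using elim(2) q \<open>t > 0\<close> by (simp add: x0_def field_simps)
        finally have "G x < ereal u'" using q w_properties(1)[OF ab] by simp
        then show ?case using u'(1) by (rule less_le_trans)
      qed
    qed
  qed
qed

lemma legendre_tendsto_zero:
  fixes x :: "'j \<Rightarrow> ereal"
  assumes "a = -\<infinity>" and x: "(x \<longlongrightarrow> -\<infinity>) F"
  shows "((\<lambda>i. legendre L (x i)) \<longlongrightarrow> 0) F"
proof -
  have "-\<infinity> < b" using slope_less_left_deriv[of lam] eps_pos assms(1) by simp
  then have ev: "\<forall>\<^sub>F i in F. x i \<in> {a..<b}"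
    using order_tendstoD(2)[OF x] assms(1) by simp
  have "((\<lambda>i. G (x i)) \<longlongrightarrow> G (-\<infinity>)) F"
    using continuous_on_tendsto_compose[OF G_continuous x _ ev] \<open>-\<infinity> < b\<close> assms(1) by simp
  then have "((\<lambda>i. - G (x i)) \<longlongrightarrow> - 0) F"
    by (intro tendsto_uminus_ereal) (simp add: G_def)
  moreover have "\<forall>\<^sub>F i in F. - G (x i) = legendre L (x i)"
    using ev by eventually_elim (simp add: legendre_eq_G)
  ultimately show ?thesis using Lim_transform_eventually by force
qed

text \<open>Each fixed \<open>s > 0\<close> bounds \<open>G z\<close> from above by an affine function that tends to \<open>-\<infinity>\<close> with
  growing \<open>z\<close>.  Conversely \<open>f\<close> is bounded below on the bounded set \<open>I\<close> by a tangent, and for bounded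
  slopes so is \<open>f(s) - s z\<close>.\<close>

lemma G_unbounded_iff:
  "(\<forall>M :: real. \<exists>z\<in>{a..<b}. G z < ereal M) \<longleftrightarrow> b = \<infinity>"
proof
  assume b: "b = \<infinity>"
  show "\<forall>M :: real. \<exists>z\<in>{a..<b}. G z < ereal M"
  proof
    fix M :: real
    define s where "s = lam + eps / 2"
    have s: "s \<in> I" "s > 0" using eps_pos lam_nonneg by (auto simp: s_def)
    define r where "r = max (d s) ((f s - M) / s + 1)"
    have "a \<le> ereal (d s)" using a_le_d[OF s(1)] .
    also have "\<dots> \<le> ereal r" by (simp add: r_def)
    finally have ab: "a \<le> ereal r" "ereal r < b" using b by auto
    have "(f s - M) / s < r" unfolding r_def by linarith
    then have "f s - s * r < M" using s(2) by (simp add: field_simps)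
    then have "G (ereal r) < ereal M" using w_le[OF ab s(1)] w_properties(1)[OF ab] by simp
    then show "\<exists>z\<in>{a..<b}. G z < ereal M" using ab by (intro bexI[of _ "ereal r"]) auto
  qed
next
  assume unb: "\<forall>M :: real. \<exists>z\<in>{a..<b}. G z < ereal M"
  show "b = \<infinity>"
  proof (rule ccontr)
    assume "b \<noteq> \<infinity>"
    define t0 where "t0 = lam + eps / 2"
    have t0: "t0 \<in> I" using eps_pos by (auto simp: t0_def)
    obtain B where B: "b = ereal B"
      using \<open>b \<noteq> \<infinity>\<close> d_less_left_deriv[OF t0] by (cases b) auto
    define M where "M = f t0 - \<bar>d t0\<bar> * eps - (lam + eps) * \<bar>B\<bar>"
    obtain z where z: "z \<in> {a..<b}" "G z < ereal (min 0 (M - 1))" using unb by blast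
    have "z \<noteq> -\<infinity>"
    proof
      assume "z = -\<infinity>"
      then have "ereal 0 < ereal (min 0 (M - 1))" using z(2) by (simp add: G_def)
      then show False by simp
    qed
    then obtain r where r: "z = ereal r" using z by (cases z) auto
    have ab: "a \<le> ereal r" "ereal r < b" using z r by auto
    obtain s where s: "s \<in> I" "f s - s * r < w r + 1" using w_properties(3)[OF ab, of 1] by auto
    have "s > 0" using s lam_nonneg by auto
    have "s * r \<le> s * \<bar>B\<bar>" using ab(2) B \<open>s > 0\<close> by (intro mult_left_mono) auto
    also have "\<dots> \<le> (lam + eps) * \<bar>B\<bar>" using s(1) by (intro mult_right_mono) auto
    finally have sr: "s * r \<le> (lam + eps) * \<bar>B\<bar>" .
    have "\<bar>d t0 * (s - t0)\<bar> \<le> \<bar>d t0\<bar> * eps"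
      unfolding abs_mult using s(1) t0 by (intro mult_left_mono) auto
    moreover have "f t0 + d t0 * (s - t0) \<le> f s" using tangent_le_f[OF t0] s I_subset_E by blast
    ultimately have "f t0 - \<bar>d t0\<bar> * eps \<le> f s" by linarith
    then have "M - 1 < w r" using sr s(2) by (simp add: M_def)
    moreover have "w r < min 0 (M - 1)" using z(2) r w_properties(1)[OF ab] by simp
    ultimately show False by simp
  qed
qed

section \<open>Affine pieces\<close>

lemma d_eq_slope_if_affine:
  assumes t: "t \<in> {lam..<lam + eps}" and aff: "affine_fun_on {t<..s} L"
    and r: "r \<in> I" "t < r" "r < s"
  shows "ereal (d r) = slope t"
proof -
  obtain p q where pq: "\<And>x. x \<in> {t<..s} \<Longrightarrow> L x = ereal (p * x + q)"
    using aff by (auto simp: affine_fun_on_def)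
  have dp: "d x = p" if x: "x \<in> I" "t < x" "x < s" for x
  proof -
    have "((\<lambda>x. p * x + q) has_real_derivative p) (at x)"
      by (auto intro!: derivative_eq_intros)
    then have "(f has_real_derivative p) (at x)"
      by (rule has_field_derivative_transform_within_open[where S = "{t<..<s}"])
        (use x pq in \<open>auto simp: f_def\<close>)
    then show ?thesis using f_has_derivative[OF x(1)] DERIV_unique by blast
  qed
  have "\<forall>\<^sub>F x in at_right t. ereal (d x) = ereal p"
    unfolding eventually_at_right_field
    using t r by (intro exI[of _ r]) (auto intro!: dp)
  then have lim: "((\<lambda>x. ereal (d x)) \<longlongrightarrow> ereal p) (at_right t)" by (rule tendsto_eventually)
  have "slope t = ereal p"
    by (rule tendsto_unique[OF _ slope_tendsto(2)[OF t] lim]) simp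
  then show ?thesis using dp[OF r] by simp
qed

lemma affine_if_d_eq_slope:
  assumes t: "t \<in> {lam..<lam + eps}" and r: "r \<in> I" "t < r" "ereal (d r) \<le> slope t"
  shows "affine_fun_on {t<..r} L"
  unfolding affine_fun_on_def
proof (intro exI ballI)
  fix s assume s: "s \<in> {t<..r}"
  then have sI: "s \<in> I" using t r by auto
  have "ereal (d r) \<le> ereal (d s)" using order_trans[OF r(3) slope_le_d[OF t sI]] s by simp
  then have ds: "d s = d r" using d_mono[OF sI r(1)] s by auto
  have "f s + d s * (r - s) \<le> f r" "f r + d r * (s - r) \<le> f s"
    using tangent_le_f sI r(1) I_subset_E by blast+
  then have "f s = d r * s + (f r - d r * r)" unfolding ds by (simp add: algebra_simps)
  then show "L s = ereal (d r * s + (f r - d r * r))" using L_eq_on_I[OF sI] by simp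
qed

lemma affine_end_le:
  assumes t: "t \<in> {lam..<lam + eps}" and s: "s \<in> I" "t < s" "slope t < ereal (d s)"
  shows "affine_end L t \<le> ereal s"
  unfolding affine_end_def
proof (intro Sup_least, elim imageE, hypsubst)
  fix u assume u: "u \<in> insert t {s. t < s \<and> affine_fun_on {t<..s} L}"
  show "ereal u \<le> ereal s"
  proof (rule ccontr)
    assume "\<not> ereal u \<le> ereal s"
    then have "s < u" by simp
    then have "affine_fun_on {t<..u} L" using u s(2) by auto
    from d_eq_slope_if_affine[OF t this s(1,2) \<open>s < u\<close>] show False using s(3) by simp
  qed
qed

lemma le_affine_end:
  assumes t: "t \<in> {lam..<lam + eps}" and s: "s \<in> I" "t < s" "ereal (d s) \<le> slope t"
  shows "ereal s \<le> affine_end L t"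
  unfolding affine_end_def
  using affine_if_d_eq_slope[OF assms] s(2) by (intro Sup_upper) auto

lemma start_le_affine_end: "ereal t \<le> affine_end L t"
  unfolding affine_end_def by (intro Sup_upper) auto

text \<open>At points that decrease to the end of the affine piece the slopes come arbitrarily close to
  the slope on that piece, but never equal it.\<close>

lemma slopes_beyond_affine_end:
  fixes s :: "nat \<Rightarrow> real"
  assumes t: "t \<in> {lam..<lam + eps}" and gt: "\<And>n. affine_end L t < ereal (s n)"
    and lim: "(\<lambda>n. ereal (s n)) \<longlonglongrightarrow> affine_end L t" and y: "slope t < y"
  obtains n where "s n \<in> I" "slope t < ereal (d (s n))" "ereal (d (s n)) < y"
proof -
  have ab: "a \<le> slope t" "slope t < b"
  proof -
    show "slope t < b" using slope_less_left_deriv[OF t] .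
    show "a \<le> slope t"
      using t slope_eq_d[of t] a_le_d[of t] by (cases "t = lam") auto
  qed
  obtain s1 where s1: "s1 \<in> I" "slope t < ereal (d s1)" "ereal (d s1) < y"
    using d_attains_between[OF ab y] by blast
  obtain s2 where s2: "s2 \<in> I" "slope t < ereal (d s2)" "ereal (d s2) < ereal (d s1)"
    using d_attains_between[OF ab s1(2)] by blast
  have "s2 < s1" using d_mono[OF s1(1) s2(1)] s2(3) by force
  have "t < s2"
  proof (rule ccontr)
    assume "\<not> t < s2"
    then have "s2 \<le> t" "t \<in> I" using s2(1) t by auto
    then show False using d_mono[OF s2(1), of t] s2(2) slope_eq_d[of t] by auto
  qed
  then have "affine_end L t \<le> ereal s2" using affine_end_le[OF t s2(1)] s2(2) by simp
  also have "\<dots> < ereal s1" using \<open>s2 < s1\<close> by simp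
  finally have "\<forall>\<^sub>F n in sequentially. ereal (s n) < ereal s1"
    by (rule order_tendstoD(2)[OF lim])
  then obtain n where n: "s n < s1" by (auto simp: eventually_sequentially)
  have tn: "t < s n"
    using le_less_trans[OF start_le_affine_end gt[of n]] by simp
  then have I: "s n \<in> I" using t n s1(1) by auto
  show ?thesis
  proof (rule that[OF I])
    show "slope t < ereal (d (s n))"
      using le_affine_end[OF t I tn] gt[of n] by (meson leD leI)
    have "d (s n) \<le> d s1" using d_mono[OF I s1(1)] n by simp
    then show "ereal (d (s n)) < y" using s1(3) by (meson ereal_less_eq(3) le_less_trans)
  qed
qed

section \<open>The transform at the left end\<close>

lemma right_lim_eq_lam:
  assumes "lam > 0"
  shows "right_lim L lam = ereal (f lam)"
proof -
  have "open {0<..<lam + eps}" "convex_on {0<..<lam + eps} f"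
    using Ico_subset_E by (auto intro!: convex_on_subset[OF f_convex])
  then have "continuous_on {0<..<lam + eps} f" by (rule convex_on_continuous)
  then have "isCont f lam"
    using assms eps_pos by (simp add: continuous_on_eq_continuous_at)
  then have "(f \<longlongrightarrow> f lam) (at_right lam)"
    unfolding isCont_def by (rule filterlim_mono) (simp_all add: at_le)
  moreover obtain R where R: "right_lim L lam = ereal R" "(f \<longlongrightarrow> R) (at_right lam)"
    using right_lim_real[of lam] eps_pos by auto
  ultimately have "R = f lam" by (intro tendsto_unique[of "at_right lam"]) simp_all
  then show ?thesis using R by simp
qed

lemma G_a_zero_iff_at_zero:
  assumes "lam = 0"
  shows "G a = 0 \<longleftrightarrow> continuous (at_right 0) L"
proof -
  obtain R where R: "right_lim L 0 = ereal R" "(f \<longlongrightarrow> R) (at_right 0)"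
    using right_lim_real[of 0] eps_pos assms by auto
  have "\<forall>\<^sub>F s in at_right 0. ereal (f s) = L s"
    unfolding eventually_at_right_field
    using assms eps_pos by (intro exI[of _ "lam + eps"]) (auto simp: L_eq_on_I)
  with tendsto_ereal[OF R(2)] have lim: "(L \<longlongrightarrow> ereal R) (at_right 0)"
    by (rule Lim_transform_eventually)
  have "G a = ereal R"
    using right_value_eq_G[of lam a] eps_pos assms R by (simp add: zero_ereal_def[symmetric])
  moreover have "continuous (at_right 0) L \<longleftrightarrow> (L \<longlongrightarrow> 0) (at_right 0)"
    by (simp add: continuous_within L_zero)
  moreover have "(L \<longlongrightarrow> 0) (at_right 0) \<longleftrightarrow> ereal R = 0"
    using lim tendsto_unique[OF _ lim, of 0] by (auto simp: zero_ereal_def[symmetric])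
  ultimately show ?thesis by simp
qed

text \<open>\<open>G a = 0\<close> says that the supporting line of slope \<open>a\<close> at \<open>lam\<close> passes through the origin.  With
  \<open>L(0) = 0\<close> convexity then forces \<open>L\<close> to equal this line on \<open>[0,lam]\<close>, so that left and right
  derivatives at \<open>lam\<close> agree.  Conversely, differentiability makes \<open>a\<close> the slope of the linear piece.\<close>

lemma G_a_zero_iff_at_pos:
  assumes "lam > 0"
  shows "G a = 0 \<longleftrightarrow> ereal_differentiable_at L lam \<and> linear_fun_on {0..lam} L"
proof -
  have lam: "lam \<in> {lam..<lam + eps}" using eps_pos by simp
  obtain z where z: "a = ereal z"
    using slope_lam_not_MInf[OF assms] slope_less_left_deriv[OF lam] by (cases a) auto
  have R: "right_lim L lam = ereal (f lam)" by (rule right_lim_eq_lam[OF assms])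
  have G: "G a = ereal (f lam - lam * z)" using G_eq_right_value[OF lam z R] z by simp
  have sub: "f lam - lam * z + s * z \<le> f s" if "s \<in> E" for s
    using right_tangent(1)[OF lam z R, of s] by (simp add: L_eq_on_E[OF that])
  have E: "0 \<in> E" "lam \<in> E" "{0..lam} \<subseteq> E" using Ico_subset_E assms eps_pos by auto
  show ?thesis
  proof
    assume "G a = 0"
    then have flam: "f lam = lam * z" using G by simp
    have lin: "f s = z * s" if s: "s \<in> {0..lam}" for s
    proof (rule antisym)
      show "z * s \<le> f s" using sub[of s] s E flam by (auto simp: mult.commute)
      show "f s \<le> z * s"
        using L_convex_on_E[OF E(1,2), of "1 - s / lam" "s / lam"] s assms E
        by (auto simp: f_zero flam L_eq_on_E[OF subsetD[OF E(3) s]] mult.commute[of z])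
    qed
    then have "linear_fun_on {0..lam} L"
      unfolding linear_fun_on_def using E by (intro exI[of _ z]) (auto simp: L_eq_on_E)
    moreover have "((\<lambda>s. (f s - f lam) / (s - lam)) \<longlongrightarrow> z) (at_left lam)"
    proof (rule tendsto_eventually)
      show "\<forall>\<^sub>F s in at_left lam. (f s - f lam) / (s - lam) = z"
        unfolding eventually_at_left_field
        using assms by (intro exI[of _ 0]) (auto simp: lin right_diff_distrib[symmetric])
    qed
    moreover have "((\<lambda>s. (f s - f lam) / (s - lam)) \<longlongrightarrow> z) (at_right lam)"
    proof (rule tendsto_sandwich)
      have I: "\<forall>\<^sub>F s in at_right lam. s \<in> I"
        unfolding eventually_at_right_field using eps_pos by (intro exI[of _ "lam + eps"]) auto
      then show "\<forall>\<^sub>F s in at_right lam. z \<le> (f s - f lam) / (s - lam)"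
      proof eventually_elim
        case (elim s)
        then have "f lam - lam * z + s * z \<le> f s" using sub I_subset_E by blast
        then show ?case using elim by (simp add: field_simps)
      qed
      show "\<forall>\<^sub>F s in at_right lam. (f s - f lam) / (s - lam) \<le> d s"
        using I
      proof eventually_elim
        case (elim s)
        have "f s + d s * (lam - s) \<le> f lam" using tangent_le_f[OF elim E(2)] .
        then show ?case using elim by (simp add: field_simps)
      qed
      show "((\<lambda>s. z) \<longlongrightarrow> z) (at_right lam)" by simp
      show "(d \<longlongrightarrow> z) (at_right lam)" using slope_tendsto(2)[OF lam] unfolding z by simp
    qed
    ultimately have "(f has_real_derivative z) (at lam)"
      unfolding has_field_derivative_iff by (intro filterlim_split_at)
    moreover have "\<forall>\<^sub>F s in nhds lam. \<bar>L s\<bar> \<noteq> \<infinity>"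
    proof -
      have "\<forall>\<^sub>F s in nhds lam. s \<in> {0<..<lam + eps}"
        using assms eps_pos by (intro eventually_nhds_in_open) auto
      then show ?thesis
        by eventually_elim (use Ico_subset_E in \<open>auto simp: L_eq_on_E subset_iff\<close>)
    qed
    ultimately have "ereal_differentiable_at L lam"
      unfolding ereal_differentiable_at_def f_def[symmetric]
      by (auto simp: real_differentiable_def)
    with \<open>linear_fun_on {0..lam} L\<close> show "ereal_differentiable_at L lam \<and> linear_fun_on {0..lam} L" by simp
  next
    assume *: "ereal_differentiable_at L lam \<and> linear_fun_on {0..lam} L"
    then obtain D where D: "(f has_real_derivative D) (at lam)"
      unfolding ereal_differentiable_at_def f_def[symmetric] by (auto simp: real_differentiable_def)
    from * obtain p where "\<And>s. s \<in> {0..lam} \<Longrightarrow> L s = ereal (p * s)"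
      unfolding linear_fun_on_def by blast
    then have p: "\<And>s. s \<in> {0..lam} \<Longrightarrow> f s = p * s" by (simp add: f_def)
    have "((\<lambda>s. (f s - f lam) / (s - lam)) \<longlongrightarrow> D) (at lam)"
      using D by (simp add: has_field_derivative_iff)
    then have "((\<lambda>s. (f s - f lam) / (s - lam)) \<longlongrightarrow> D) (at_left lam)"
      by (simp add: filterlim_at_split)
    moreover have "((\<lambda>s. (f s - f lam) / (s - lam)) \<longlongrightarrow> p) (at_left lam)"
    proof (rule tendsto_eventually)
      show "\<forall>\<^sub>F s in at_left lam. (f s - f lam) / (s - lam) = p"
        unfolding eventually_at_left_field
        using assms by (intro exI[of _ 0]) (auto simp: p right_diff_distrib[symmetric])
    qed
    ultimately have "D = p" by (intro tendsto_unique[of "at_left lam"]) simp_all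
    have "D - z = 0"
    proof (rule DERIV_local_min)
      show "((\<lambda>s. f s - z * s) has_real_derivative D - z) (at lam)"
        by (auto intro!: derivative_eq_intros D)
      show "0 < min lam eps" using assms eps_pos by simp
      show "\<forall>y. \<bar>lam - y\<bar> < min lam eps \<longrightarrow> f lam - z * lam \<le> f y - z * y"
      proof (intro allI impI)
        fix y assume "\<bar>lam - y\<bar> < min lam eps"
        then have "y \<in> {0..<lam + eps}" by (simp add: abs_less_iff)
        then have "y \<in> E" using Ico_subset_E by blast
        from sub[OF this] show "f lam - z * lam \<le> f y - z * y" by (simp add: algebra_simps)
      qed
    qed
    then show "G a = 0" using G p[of lam] \<open>D = p\<close> assms by (simp add: mult.commute)
  qed
qed

section \<open>Strict concavity and differentiability\<close>

text \<open>If equality held, \<open>t\<close> would minimise \<open>f(s) - s r\<close> in the interior of \<open>I\<close>, so that \<open>d t = r\<close>.\<close>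

lemma w_less:
  assumes t: "t \<in> I" and r: "a \<le> ereal r" "ereal r < b" and "r \<noteq> d t"
  shows "w r < f t - t * r"
proof (rule ccontr)
  assume "\<not> w r < f t - t * r"
  then have min: "f t - r * t \<le> f s - r * s" if "s \<in> I" for s
    using w_le[OF r that] by (simp add: mult.commute)
  have "d t - r = 0"
  proof (rule DERIV_local_min)
    show "((\<lambda>s. f s - r * s) has_real_derivative d t - r) (at t)"
      by (auto intro!: derivative_eq_intros f_has_derivative[OF t])
    show "0 < min (t - lam) (lam + eps - t)" using t by simp
    show "\<forall>y. \<bar>t - y\<bar> < min (t - lam) (lam + eps - t) \<longrightarrow> f t - r * t \<le> f y - r * y"
      by (auto intro!: min)
  qed
  then show False using \<open>r \<noteq> d t\<close> by simp
qed

lemma w_strict_concave: "strict_concave_on {r. a < ereal r \<and> ereal r < b} w"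
  unfolding strict_concave_on_def strict_convex_on_def
proof (intro conjI ballI allI impI)
  let ?S = "{r. a < ereal r \<and> ereal r < b}"
  show conv: "convex ?S"
    unfolding is_interval_convex_1[symmetric] is_interval_1
  proof (intro ballI allI impI)
    fix p q x assume pq: "p \<in> ?S" "q \<in> ?S" and "p \<le> x \<and> x \<le> q"
    then have "ereal p \<le> ereal x" "ereal x \<le> ereal q" by simp_all
    then show "x \<in> ?S" using pq less_le_trans le_less_trans by blast
  qed
  fix r1 r2 u v :: real
  assume r: "r1 \<in> ?S" "r2 \<in> ?S" and uv: "0 < u" "0 < v" "r1 \<noteq> r2" "u + v = 1"
  have "u * r1 + v * r2 \<in> ?S" using convexD[OF conv r, of u v] uv by simp
  then obtain t where t: "t \<in> I" "d t = u * r1 + v * r2" using d_attains by blast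
  have v: "v = 1 - u" using uv by simp
  have "d t - r1 = v * (r2 - r1)" "d t - r2 = u * (r1 - r2)"
    unfolding t(2) v by (simp_all add: algebra_simps)
  then have ne: "r1 \<noteq> d t" "r2 \<noteq> d t" using uv by auto
  have "w r1 < f t - t * r1" "w r2 < f t - t * r2"
    using w_less[OF t(1)] r ne by (auto simp: less_imp_le)
  then have "u * w r1 + v * w r2 < u * (f t - t * r1) + v * (f t - t * r2)"
    using uv by (intro add_strict_mono mult_strict_left_mono) auto
  also have "\<dots> = f t - t * d t" unfolding t(2) v by (simp add: algebra_simps)
  also have "\<dots> = w (d t)" using w_d[OF t(1)] by simp
  finally show "- w (u * r1 + v * r2) < u * - w r1 + v * - w r2" unfolding t(2) by simp
qed

text \<open>Strict convexity beyond the affine piece makes \<open>d\<close> strictly increasing there, so slopes \<open>r\<close> close to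
  \<open>d t0\<close> belong to points \<open>t\<close> close to \<open>t0\<close>.  The affine functions that touch \<open>w\<close> at \<open>r\<close> and at \<open>d t0\<close>
  squeeze the difference quotient between \<open>-t\<close> and \<open>-t0\<close>.\<close>

lemma w_has_derivative:
  assumes sc: "strict_convex_on {r. affine_end L lam < ereal r \<and> r < lam + eps} f"
    and t0: "t0 \<in> I" "a < ereal (d t0)"
  shows "(w has_real_derivative - t0) (at (d t0))"
proof -
  have lam: "lam \<in> {lam..<lam + eps}" using eps_pos by simp
  define J where "J = {r. affine_end L lam < ereal r \<and> r < lam + eps}"
  have JI: "J \<subseteq> I"
    using le_less_trans[OF start_le_affine_end] by (force simp: J_def)
  obtain s where s: "s \<in> I" "a < ereal (d s)" "ereal (d s) < ereal (d t0)"
    using d_attains_between[of a "ereal (d t0)"] t0 slope_less_left_deriv[OF lam] by blast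
  have st0: "s < t0" using d_mono[OF t0(1) s(1)] s(3) by force
  have "affine_end L lam \<le> ereal s" using affine_end_le[OF lam s(1)] s by simp
  then have inJ: "t \<in> J" if "s < t" "t < lam + eps" for t
    using that unfolding J_def by (auto intro: le_less_trans)
  have d_strict: "d t < d t'" if t: "t \<in> J" "t' \<in> J" "t < t'" for t t'
  proof -
    have I: "t \<in> I" "t' \<in> I" using t JI by auto
    have "f (u * x + v * y) < u * f x + v * f y"
      if "x \<in> J" "y \<in> J" "0 < u" "0 < v" "x \<noteq> y" "u + v = 1" for x y u v
      using sc that unfolding strict_convex_on_def J_def[symmetric] by blast
    from this[OF t(1,2), of "1 / 2" "1 / 2"]
    have "f (1 / 2 * t + 1 / 2 * t') < 1 / 2 * f t + 1 / 2 * f t'"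
      using t(3) by simp
    moreover have "f t + d t * ((1 / 2 * t + 1 / 2 * t') - t) \<le> f (1 / 2 * t + 1 / 2 * t')"
    proof (rule tangent_le_f[OF I(1)])
      have "1 / 2 * t + 1 / 2 * t' \<in> I" using I by auto
      then show "1 / 2 * t + 1 / 2 * t' \<in> E" using I_subset_E by blast
    qed
    moreover have "f t' + d t' * (t - t') \<le> f t" using tangent_le_f[OF I(2)] I I_subset_E by blast
    ultimately have "(d t' - d t) * (t' - t) > 0" by (simp add: algebra_simps)
    then show ?thesis using t(3) by (simp add: zero_less_mult_iff)
  qed
  show ?thesis
    unfolding has_field_derivative_iff
  proof (rule tendstoI)
    fix e :: real assume "0 < e"
    define t1 where "t1 = max ((s + t0) / 2) (t0 - e / 2)"
    define t2 where "t2 = min ((t0 + (lam + eps)) / 2) (t0 + e / 2)"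
    have t12: "t1 < t0" "t0 < t2" "s < t1" "t2 < lam + eps" "t0 - e < t1" "t2 < t0 + e"
      using st0 t0 \<open>0 < e\<close> by (auto simp: t1_def t2_def max_def min_def)
    then have J: "t1 \<in> J" "t0 \<in> J" "t2 \<in> J" by (auto intro!: inJ)
    then have I: "t1 \<in> I" "t2 \<in> I" using JI by auto
    have "d t1 < d t0" "d t0 < d t2" using d_strict J t12 by auto
    have id: "((\<lambda>x. x) \<longlongrightarrow> d t0) (at (d t0))" by (rule tendsto_ident_at)
    have "\<forall>\<^sub>F r in at (d t0). r \<noteq> d t0" by (rule eventually_neq_at_within)
    with order_tendstoD(1)[OF id \<open>d t1 < d t0\<close>] order_tendstoD(2)[OF id \<open>d t0 < d t2\<close>]
    show "\<forall>\<^sub>F r in at (d t0). dist ((w r - w (d t0)) / (r - d t0)) (- t0) < e"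
    proof eventually_elim
      case (elim r)
      have "t1 < t2" using t12 by simp
      then obtain t where t: "t1 < t" "t < t2" "d t = r"
        using d_intermediate[OF I, of r] elim by blast
      then have tI: "t \<in> I" using I by auto
      have "w r \<le> f t0 - t0 * r" using w_le[OF _ _ t0(1), of r] a_le_d[OF tI] d_less_left_deriv[OF tI] t by simp
      moreover have "w (d t0) \<le> f t - t * d t0"
        using w_le[OF _ _ tI] a_le_d[OF t0(1)] d_less_left_deriv[OF t0(1)] by simp
      moreover have "w r = f t - t * r" using w_d[OF tI] t by simp
      moreover have "w (d t0) = f t0 - t0 * d t0" using w_d[OF t0(1)] .
      ultimately have up: "w r - w (d t0) + t0 * (r - d t0) \<le> 0"
        and lo: "(t0 - t) * (r - d t0) \<le> w r - w (d t0) + t0 * (r - d t0)"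
        by (simp_all add: algebra_simps)
      have "\<bar>w r - w (d t0) + t0 * (r - d t0)\<bar> \<le> \<bar>(t0 - t) * (r - d t0)\<bar>"
        using up lo by linarith
      also have "\<dots> < e * \<bar>r - d t0\<bar>"
        unfolding abs_mult using t t12 elim by (intro mult_strict_right_mono) auto
      finally have "\<bar>w r - w (d t0) + t0 * (r - d t0)\<bar> / \<bar>r - d t0\<bar> < e"
        using elim by (simp add: divide_less_eq)
      moreover have "(w r - w (d t0)) / (r - d t0) - (- t0) = (w r - w (d t0) + t0 * (r - d t0)) / (r - d t0)"
        using elim by (simp add: field_simps)
      ultimately show ?case by (simp add: dist_real_def)
    qed
  qed
qed

section \<open>Summary for functions that agree with the transform\<close>

lemma transform_properties:
  assumes "\<forall>z\<in>{a..<b}. g z = G z"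
  shows "g ` {a..<b} \<subseteq> {-\<infinity><..0}"
    and "strict_antimono_on {a..<b} g"
    and "continuous_on {a..<b} g"
    and "(\<forall>M :: real. \<exists>z\<in>{a..<b}. g z < ereal M) \<longleftrightarrow> b = \<infinity>"
    and "g a = 0 \<longleftrightarrow> (lam > 0 \<and> ereal_differentiable_at L lam \<and> linear_fun_on {0..lam} L) \<or>
           (lam = 0 \<and> continuous (at_right 0) L)"
    and "strict_concave_on {r. a < ereal r \<and> ereal r < b} (\<lambda>r. real_of_ereal (g (ereal r)))"
    and "strict_convex_on {r. affine_end L lam < ereal r \<and> r < lam + eps} (\<lambda>r. real_of_ereal (L r)) \<Longrightarrow>
         a < ereal r \<Longrightarrow> ereal r < b \<Longrightarrow> (\<lambda>r. real_of_ereal (g (ereal r))) differentiable (at r)"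
proof -
  let ?S = "{r. a < ereal r \<and> ereal r < b}"
  note g = bspec[OF assms]
  have gw: "real_of_ereal (g (ereal r)) = w r" if "r \<in> ?S" for r
    using g[of "ereal r"] that by (simp add: w_def less_imp_le)
  show "g ` {a..<b} \<subseteq> {-\<infinity><..0}"
    using G_bounds g by auto
  show "strict_antimono_on {a..<b} g"
  proof (rule monotone_onI)
    fix z1 z2 assume z: "z1 \<in> {a..<b}" "z2 \<in> {a..<b}" "z1 < z2"
    then show "g z2 < g z1" unfolding g[OF z(1)] g[OF z(2)] by (rule G_strict_antimono)
  qed
  show "continuous_on {a..<b} g"
    using G_continuous by (subst continuous_on_cong[OF refl g])
  show "(\<forall>M :: real. \<exists>z\<in>{a..<b}. g z < ereal M) \<longleftrightarrow> b = \<infinity>"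
    unfolding G_unbounded_iff[symmetric] using g by auto
  have "a < b" using slope_less_left_deriv[of lam] eps_pos by simp
  then have "g a = G a" by (intro g) auto
  then show "g a = 0 \<longleftrightarrow> (lam > 0 \<and> ereal_differentiable_at L lam \<and> linear_fun_on {0..lam} L) \<or>
           (lam = 0 \<and> continuous (at_right 0) L)"
    using G_a_zero_iff_at_zero G_a_zero_iff_at_pos lam_nonneg by (cases "lam = 0") auto
  show "strict_concave_on ?S (\<lambda>r. real_of_ereal (g (ereal r)))"
    unfolding strict_concave_on_def strict_convex_on_def
  proof (intro conjI ballI allI impI)
    show conv: "convex ?S"
      using w_strict_concave by (simp add: strict_concave_on_def strict_convex_on_def)
    fix r1 r2 u v :: real
    assume r: "r1 \<in> ?S" "r2 \<in> ?S" and uv: "0 < u" "0 < v" "r1 \<noteq> r2" "u + v = 1"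
    have "u * r1 + v * r2 \<in> ?S" using convexD[OF conv r, of u v] uv by simp
    moreover have "- w (u * r1 + v * r2) < u * - w r1 + v * - w r2"
      using w_strict_concave r uv unfolding strict_concave_on_def strict_convex_on_def by blast
    ultimately show "- real_of_ereal (g (ereal (u * r1 + v * r2)))
        < u * - real_of_ereal (g (ereal r1)) + v * - real_of_ereal (g (ereal r2))"
      by (simp only: gw r)
  qed
  show "(\<lambda>r. real_of_ereal (g (ereal r))) differentiable (at r)"
    if sc: "strict_convex_on {r. affine_end L lam < ereal r \<and> r < lam + eps} (\<lambda>r. real_of_ereal (L r))"
      and r: "a < ereal r" "ereal r < b"
  proof -
    obtain t where t: "t \<in> I" "d t = r" using d_attains r by blast
    have "(w has_real_derivative - t) (at r)"
      using w_has_derivative[OF sc[folded f_def] t(1)] t(2) r(1) by simp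
    moreover have "open ?S"
      by (intro open_Collect_conj open_Collect_less continuous_intros continuous_on_ereal)
    ultimately have "((\<lambda>r. real_of_ereal (g (ereal r))) has_real_derivative - t) (at r)"
      by (rule has_field_derivative_transform_within_open) (use r gw in auto)
    then show ?thesis by (auto simp: real_differentiable_def)
  qed
qed

end

section \<open>Tail probabilities along the net\<close>

locale differentiable_prob_net =
  scaled_prob_net F \<mu> c + differentiable_convex "upper_log_mgf F \<mu> c" lam eps
  for F :: "'i filter" and \<mu> :: "'i \<Rightarrow> real measure" and c :: "'i \<Rightarrow> real" and lam eps :: real
begin

lemma Limsup_prob_le_G:
  assumes z: "z \<in> {a..<b}" and x: "(x \<longlongrightarrow> z) F"
  shows "Limsup F (scaled_log_prob \<mu> c (\<lambda>i. {x i..y i})) \<le> G z"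
proof (cases "z = -\<infinity>")
  case True
  then have "G z = 0" by (simp add: G_def)
  moreover have "\<forall>\<^sub>F i in F. scaled_log_prob \<mu> c (\<lambda>i. {x i..y i}) i \<le> 0"
    using scaled_log_prob_nonpos by eventually_elim simp
  ultimately show ?thesis by (simp add: Limsup_bounded)
next
  case False
  then obtain r where r: "z = ereal r" using z by (cases z) auto
  then have ab: "a \<le> ereal r" "ereal r < b" using z by auto
  have "Limsup F (scaled_log_prob \<mu> c (\<lambda>i. {x i..y i})) \<le> ereal (w r)"
  proof (rule ereal_le_epsilon2)
    fix e :: real assume "0 < e"
    then obtain s where s: "s \<in> I" "f s - s * r < w r + e"
      using w_properties(3)[OF ab] by blast
    have "Limsup F (scaled_log_prob \<mu> c (\<lambda>i. {x i..y i})) \<le> ereal ((w r + e + s * r) - s * r)"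
    proof (rule Limsup_scaled_log_prob_upper)
      show "s \<ge> 0" using s(1) lam_nonneg by auto
      show "L s < ereal (w r + e + s * r)" using s by (simp add: L_eq_on_I)
      show "(x \<longlongrightarrow> ereal r) F" using x r by simp
    qed
    then show "Limsup F (scaled_log_prob \<mu> c (\<lambda>i. {x i..y i})) \<le> ereal (w r) + ereal e" by simp
  qed
  then show ?thesis using r w_properties(1)[OF ab] by simp
qed

text \<open>The bound at a single \<open>s\<close> for which \<open>d s\<close> lies strictly between the limit of \<open>x\<close> and the lower limit of
  \<open>y\<close>: a neighbourhood \<open>]w0,w1[\<close> of \<open>d s\<close> is eventually contained in \<open>]x,y[\<close>.\<close>

lemma prob_lower_near_exposed_point:
  assumes s: "s \<in> I" and x: "(x \<longlongrightarrow> z) F" "z < ereal (d s)" and y: "ereal (d s) < Liminf F y"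
    and "e > 0"
  obtains A where "ereal A < L s"
    "\<forall>\<^sub>F i in F. ereal A < scaled_log_mgf \<mu> c s i \<longrightarrow>
      ereal (f s - s * d s - e) \<le> scaled_log_prob \<mu> c (\<lambda>i. {x i<..<y i}) i"
proof -
  have "s > 0" using s lam_nonneg by auto
  obtain v where v: "z < v" "v < ereal (d s)" using dense[OF x(2)] by blast
  then obtain w0 where w0: "v = ereal w0" by (cases v) auto
  have "ereal (d s) < min (Liminf F y) (ereal (d s + e / (4 * s)))"
    using y \<open>e > 0\<close> \<open>s > 0\<close> by simp
  then obtain v' where v': "ereal (d s) < v'" "v' < Liminf F y" "v' < ereal (d s + e / (4 * s))"
    using dense by (metis min_less_iff_conj)
  then obtain w1 where w1: "v' = ereal w1" by (cases v') auto
  have sw1: "s * w1 \<le> s * d s + e / 4"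
  proof -
    have "s * w1 \<le> s * (d s + e / (4 * s))" using v'(3) w1 \<open>s > 0\<close> by simp
    then show ?thesis using \<open>s > 0\<close> by (simp add: distrib_left)
  qed
  obtain \<theta> \<delta> where gap: "\<theta> > 0" "\<delta> > 0"
    "L (s + \<theta>) < ereal (f s - 2 * \<delta> + \<theta> * w1)" "L (s - \<theta>) < ereal (f s - 2 * \<delta> - \<theta> * w0)"
    using slope_gap[OF s, of w0 w1] v v' w0 w1 by auto
  \<comment> \<open>Three of the four quarters of \<open>e\<close> pay for \<open>A\<close>, for \<open>w1\<close> and for the shrinking term \<open>c log 2\<close>.\<close>
  define A where "A = f s - min \<delta> (e / 4)"
  have A: "A < f s" "f s - \<delta> \<le> A" "f s - e / 4 \<le> A"
    using gap(2) \<open>e > 0\<close> by (auto simp: A_def)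
  show ?thesis
  proof (rule that[of A])
    show "ereal A < L s" using A(1) by (simp add: L_eq_on_I[OF s])
    have "ereal (f s - 2 * \<delta> + \<theta> * w1) \<le> ereal (A - \<delta> + \<theta> * w1)"
      "ereal (f s - 2 * \<delta> - \<theta> * w0) \<le> ereal (A - \<delta> - \<theta> * w0)"
      using A(2) by simp_all
    then have "\<forall>\<^sub>F i in F. ereal A < scaled_log_mgf \<mu> c s i \<longrightarrow>
        ereal (A - s * w1 - e / 4) \<le> scaled_log_prob \<mu> c (\<lambda>i. {x i<..<y i}) i"
      using \<open>s > 0\<close> gap x(1) v v' w0 w1 \<open>e > 0\<close>
      by (intro eventually_scaled_log_prob_lower[of s \<theta> \<delta> A w1 w0]) (auto intro: less_le_trans)
    then show "\<forall>\<^sub>F i in F. ereal A < scaled_log_mgf \<mu> c s i \<longrightarrow>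
      ereal (f s - s * d s - e) \<le> scaled_log_prob \<mu> c (\<lambda>i. {x i<..<y i}) i"
    proof eventually_elim
      case (elim i)
      have "ereal (f s - s * d s - e) \<le> ereal (A - s * w1 - e / 4)"
        using A(3) sw1 \<open>e > 0\<close> by simp
      then show ?case using elim by (blast intro: order_trans)
    qed
  qed
qed

text \<open>A smaller upper limit of the probabilities would keep the moment generating function at some \<open>s\<close>
  eventually below a level that is smaller than its upper limit \<open>L s\<close>.\<close>

lemma G_le_Limsup_prob:
  assumes z: "z \<in> {a..<b}" and x: "(x \<longlongrightarrow> z) F" and y: "z < Liminf F y"
  shows "G z \<le> Limsup F (scaled_log_prob \<mu> c (\<lambda>i. {x i<..<y i}))" (is "_ \<le> Limsup F ?X")
proof (rule ccontr)
  assume "\<not> G z \<le> Limsup F ?X"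
  then obtain v where v: "Limsup F ?X < v" "v < G z" using dense by (auto simp: not_le)
  then obtain l where l: "v = ereal l" by (cases v) auto
  obtain y0 where y0: "z < y0" "\<And>s. s \<in> I \<Longrightarrow> z < ereal (d s) \<Longrightarrow> ereal (d s) < y0 \<Longrightarrow> v < ereal (f s - s * d s)"
    using G_lower_right[OF z v(2)] by blast
  obtain s where s: "s \<in> I" "z < ereal (d s)" "ereal (d s) < min y0 (Liminf F y)"
    using d_attains_between[of z "min y0 (Liminf F y)"] z y y0(1) by auto
  define e where "e = f s - s * d s - l"
  have "e > 0" using y0(2)[OF s(1,2)] s(3) l by (simp add: e_def)
  obtain A where A: "ereal A < L s"
    "\<forall>\<^sub>F i in F. ereal A < scaled_log_mgf \<mu> c s i \<longrightarrow> ereal (f s - s * d s - e) \<le> ?X i"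
    using prob_lower_near_exposed_point[OF s(1) x s(2) _ \<open>e > 0\<close>, of y] s(3) by auto
  have "\<forall>\<^sub>F i in F. ?X i < ereal l" using Limsup_lessD[OF v(1)] l by simp
  with A(2) have "\<forall>\<^sub>F i in F. scaled_log_mgf \<mu> c s i \<le> ereal A"
    by eventually_elim (auto simp: e_def not_less[symmetric])
  then have "L s \<le> ereal A" unfolding upper_log_mgf_def by (rule Limsup_bounded)
  then show False using A(1) by simp
qed

text \<open>Here \<open>s\<close> is taken from the sequence along which \<open>L\<close> is a limit.  Its slopes are larger than \<open>z\<close>
  since the sequence lies beyond the affine piece.\<close>

lemma G_le_Liminf_prob:
  assumes t: "t \<in> {lam..<lam + eps}" "slope t = z" and z: "z \<in> {a..<b}"
    and x: "(x \<longlongrightarrow> z) F" and y: "z < Liminf F y"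
    and s: "\<And>n. affine_end L t < ereal (s n)" "(\<lambda>n. ereal (s n)) \<longlonglongrightarrow> affine_end L t"
      "\<And>n. log_mgf_exists F \<mu> c (s n)"
  shows "G z \<le> Liminf F (scaled_log_prob \<mu> c (\<lambda>i. {x i<..<y i}))" (is "_ \<le> Liminf F ?X")
proof (rule ccontr)
  assume "\<not> G z \<le> Liminf F ?X"
  then obtain v where v: "Liminf F ?X < v" "v < G z" using dense by (auto simp: not_le)
  then obtain l where l: "v = ereal l" by (cases v) auto
  obtain y0 where y0: "z < y0" "\<And>s. s \<in> I \<Longrightarrow> z < ereal (d s) \<Longrightarrow> ereal (d s) < y0 \<Longrightarrow> v < ereal (f s - s * d s)"
    using G_lower_right[OF z v(2)] by blast
  have "slope t < min y0 (Liminf F y)" using t(2) y y0(1) by simp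
  then obtain n where n: "s n \<in> I" "slope t < ereal (d (s n))" "ereal (d (s n)) < min y0 (Liminf F y)"
    using slopes_beyond_affine_end[OF t(1) s(1,2)] by blast
  define e where "e = f (s n) - s n * d (s n) - l"
  have "e > 0" using y0(2)[OF n(1)] n(2,3) t(2) l by (simp add: e_def)
  obtain A where A: "ereal A < L (s n)"
    "\<forall>\<^sub>F i in F. ereal A < scaled_log_mgf \<mu> c (s n) i \<longrightarrow> ereal (f (s n) - s n * d (s n) - e) \<le> ?X i"
    using prob_lower_near_exposed_point[OF n(1) x _ _ \<open>e > 0\<close>, of y] n(2,3) t(2) by auto
  have "\<forall>\<^sub>F i in F. ereal A < scaled_log_mgf \<mu> c (s n) i"
    using order_tendstoD(1)[OF s(3)[of n, unfolded log_mgf_exists_def] A(1)] .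
  with A(2) have "\<forall>\<^sub>F i in F. ereal l \<le> ?X i"
    by eventually_elim (simp add: e_def)
  then have "ereal l \<le> Liminf F ?X" by (rule Liminf_bounded)
  then show False using v(1) l by simp
qed

lemma scaled_log_prob_open_le_closed:
  "\<forall>\<^sub>F i in F. scaled_log_prob \<mu> c (\<lambda>i. {x i<..<y i}) i \<le> scaled_log_prob \<mu> c (\<lambda>i. {x i..y i}) i"
  using eventually_prob
proof eventually_elim
  case (elim i)
  have "emeasure (distr (\<mu> i) borel ereal) {x i<..<y i} \<le> emeasure (distr (\<mu> i) borel ereal) {x i..y i}"
    by (rule emeasure_mono) auto
  then show ?case using elim by (simp add: scaled_log_prob_def scaled_elog_mono)
qed

lemma Limsup_prob_eq_G:
  assumes z: "z \<in> {a..<b}" and x: "(x \<longlongrightarrow> z) F" and y: "z < Liminf F y"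
  shows "Limsup F (scaled_log_prob \<mu> c (\<lambda>i. {x i..y i})) = G z"
    and "Limsup F (scaled_log_prob \<mu> c (\<lambda>i. {x i<..<y i})) = G z"
  using Limsup_prob_le_G[OF z x, of y] G_le_Limsup_prob[OF assms]
    Limsup_mono[OF scaled_log_prob_open_le_closed[of x y]] by auto

lemma prob_tendsto_G:
  assumes t: "t \<in> {lam..<lam + eps}" "slope t = z" and z: "z \<in> {a..<b}"
    and x: "(x \<longlongrightarrow> z) F" and y: "z < Liminf F y"
    and s: "\<And>n. affine_end L t < ereal (s n)" "(\<lambda>n. ereal (s n)) \<longlonglongrightarrow> affine_end L t"
      "\<And>n. log_mgf_exists F \<mu> c (s n)"
  shows "(scaled_log_prob \<mu> c (\<lambda>i. {x i..y i}) \<longlongrightarrow> G z) F"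
    and "(scaled_log_prob \<mu> c (\<lambda>i. {x i<..<y i}) \<longlongrightarrow> G z) F"
proof -
  have "G z \<le> Liminf F (scaled_log_prob \<mu> c (\<lambda>i. {x i<..<y i}))"
    by (rule G_le_Liminf_prob[OF assms])
  moreover have "\<dots> \<le> Liminf F (scaled_log_prob \<mu> c (\<lambda>i. {x i..y i}))"
    by (rule Liminf_mono[OF scaled_log_prob_open_le_closed])
  moreover note Limsup_prob_eq_G[OF z x y]
    Liminf_le_Limsup[OF nontrivial, of "scaled_log_prob \<mu> c (\<lambda>i. {x i..y i})"]
    Liminf_le_Limsup[OF nontrivial, of "scaled_log_prob \<mu> c (\<lambda>i. {x i<..<y i})"]
  ultimately show "(scaled_log_prob \<mu> c (\<lambda>i. {x i..y i}) \<longlongrightarrow> G z) F"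
    "(scaled_log_prob \<mu> c (\<lambda>i. {x i<..<y i}) \<longlongrightarrow> G z) F"
    unfolding tendsto_iff_Liminf_eq_Limsup[OF nontrivial] by auto
qed

end
theorem corollary1:
  fixes D :: "'i set" and le :: "'i \<Rightarrow> 'i \<Rightarrow> bool" and F :: "'i filter"
    and \<mu> :: "'i \<Rightarrow> real measure" and c :: "'i \<Rightarrow> real"
    and L :: "real \<Rightarrow> ereal" and lam eps :: real and a b :: ereal
  assumes "directed_set D le"
    and "F = net_filter D le"
    and "\<And>i. i \<in> D \<Longrightarrow> prob_space (\<mu> i)"
    and "\<And>i. i \<in> D \<Longrightarrow> sets (\<mu> i) = sets borel"
    and "\<And>i. i \<in> D \<Longrightarrow> c i > 0"
    and "(c \<longlongrightarrow> 0) F"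
    and "L = upper_log_mgf F \<mu> c"
    and "lam \<ge> 0" and "eps > 0"
    and "\<And>t. t \<in> {lam<..<lam + eps} \<Longrightarrow> ereal_differentiable_at L t"
    and "(SUP t\<in>{lam<..<lam + eps}. ereal_deriv L t) \<notin> ereal_deriv L ` {lam<..<lam + eps}"
    and "lam = 0 \<Longrightarrow> right_lim (right_deriv L) 0 = -\<infinity> \<Longrightarrow> continuous (at_right 0) L"
    and "a = right_lim (right_deriv L) lam"
    and "b = left_deriv L (lam + eps)"
  shows
    "(\<forall>z\<in>{a..<b}.
        (\<exists>t\<in>{lam..<lam + eps}. right_lim (right_deriv L) t = z) \<and>
        (\<forall>t\<in>{lam..<lam + eps}. \<forall>x y :: 'i \<Rightarrow> ereal.
           right_lim (right_deriv L) t = z \<longrightarrow> (x \<longlongrightarrow> z) F \<longrightarrow> Liminf F y > z \<longrightarrow>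
           Limsup F (scaled_log_prob \<mu> c (\<lambda>i. {x i..y i})) = right_lim L t - ereal t * z \<and>
           Limsup F (scaled_log_prob \<mu> c (\<lambda>i. {x i<..<y i})) = right_lim L t - ereal t * z \<and>
           (z \<noteq> -\<infinity> \<longrightarrow>
              right_lim L t - ereal t * z = - legendre L z \<and>
              - legendre L z = (INF s\<in>{0<..}. L s - ereal s * z)) \<and>
           (z = -\<infinity> \<longrightarrow>
              lam = 0 \<and> right_lim (right_deriv L) 0 = -\<infinity> \<and>
              right_lim L t - ereal t * z = 0 \<and>
              ((\<lambda>i. legendre L (x i)) \<longlongrightarrow> 0) F) \<and>
           ((\<exists>s :: nat \<Rightarrow> real.
               (\<forall>n. affine_end L t < ereal (s n)) \<and>
               (\<lambda>n. ereal (s n)) \<longlonglongrightarrow> affine_end L t \<and>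
               (\<forall>n. log_mgf_exists F \<mu> c (s n))) \<longrightarrow>
              (scaled_log_prob \<mu> c (\<lambda>i. {x i..y i})
                 \<longlongrightarrow> Limsup F (scaled_log_prob \<mu> c (\<lambda>i. {x i..y i}))) F \<and>
              (scaled_log_prob \<mu> c (\<lambda>i. {x i<..<y i})
                 \<longlongrightarrow> Limsup F (scaled_log_prob \<mu> c (\<lambda>i. {x i<..<y i}))) F)))
     \<and>
     (\<forall>(\<tau> :: ereal \<Rightarrow> real) (g :: ereal \<Rightarrow> ereal).
        (\<forall>z\<in>{a..<b}. \<tau> z \<in> {lam..<lam + eps} \<and> right_lim (right_deriv L) (\<tau> z) = z) \<longrightarrow>
        (\<forall>z. g z = right_lim L (\<tau> z) - ereal (\<tau> z) * z) \<longrightarrow>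
        g ` {a..<b} \<subseteq> {-\<infinity><..0} \<and>
        strict_antimono_on {a..<b} g \<and>
        continuous_on {a..<b} g \<and>
        ((\<forall>M :: real. \<exists>z\<in>{a..<b}. g z < ereal M) \<longleftrightarrow> b = \<infinity>) \<and>
        (g a = 0 \<longleftrightarrow>
           (lam > 0 \<and> ereal_differentiable_at L lam \<and> linear_fun_on {0..lam} L) \<or>
           (lam = 0 \<and> continuous (at_right 0) L)) \<and>
        strict_concave_on {r. a < ereal r \<and> ereal r < b} (\<lambda>r. real_of_ereal (g (ereal r))) \<and>
        (strict_convex_on {r. affine_end L lam < ereal r \<and> r < lam + eps} (\<lambda>r. real_of_ereal (L r)) \<longrightarrow>
           (\<forall>r. a < ereal r \<longrightarrow> ereal r < b \<longrightarrow>
              (\<lambda>r. real_of_ereal (g (ereal r))) differentiable (at r))))"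
proof -
  have eventually_D: "\<forall>\<^sub>F i in F. i \<in> D"
    using assms(1,2) eventually_net_filter_mem by simp
  interpret scaled_prob_net F \<mu> c
  proof
    show "F \<noteq> bot" using assms(1,2) net_filter_nontrivial by simp
    show "\<forall>\<^sub>F i in F. prob_space (\<mu> i) \<and> sets (\<mu> i) = sets borel \<and> 0 < c i"
      using eventually_D by eventually_elim (simp add: assms(3-5))
    show "(c \<longlongrightarrow> 0) F" by fact
  qed
  interpret differentiable_prob_net F \<mu> c lam eps
    using assms(8-12) unfolding assms(7)
    by unfold_locales (auto intro: upper_log_mgf_convex upper_log_mgf_zero)
  show ?thesis
    unfolding assms(7,13,14)
  proof (intro conjI ballI allI impI)
    fix z assume z: "z \<in> {slope lam..<left_deriv (upper_log_mgf F \<mu> c) (lam + eps)}"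
    show "\<exists>t\<in>{lam..<lam + eps}. slope t = z" by (rule slope_attains[OF z])
    fix t x y
    assume t: "t \<in> {lam..<lam + eps}" "slope t = z" and x: "(x \<longlongrightarrow> z) F" and y: "z < Liminf F y"
    note value_eq = right_value_eq_G[OF t] and Limsup_eq = Limsup_prob_eq_G[OF z x y]
    show "Limsup F (scaled_log_prob \<mu> c (\<lambda>i. {x i..y i})) = right_lim (upper_log_mgf F \<mu> c) t - ereal t * z"
      "Limsup F (scaled_log_prob \<mu> c (\<lambda>i. {x i<..<y i})) = right_lim (upper_log_mgf F \<mu> c) t - ereal t * z"
      unfolding value_eq Limsup_eq by (rule refl)+
    show "right_lim (upper_log_mgf F \<mu> c) t - ereal t * z = - legendre (upper_log_mgf F \<mu> c) z"
      unfolding value_eq legendre_eq_G[OF z] by simp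
    show "- legendre (upper_log_mgf F \<mu> c) z = (INF s\<in>{0<..}. upper_log_mgf F \<mu> c s - ereal s * z)"
      if "z \<noteq> -\<infinity>"
      unfolding legendre_eq_G[OF z] using that by (simp add: G_def)
    show "lam = 0" "slope 0 = -\<infinity>" "right_lim (upper_log_mgf F \<mu> c) t - ereal t * z = 0"
      "((\<lambda>i. legendre (upper_log_mgf F \<mu> c) (x i)) \<longlongrightarrow> 0) F" if "z = -\<infinity>"
    proof -
      show "lam = 0" "slope 0 = -\<infinity>" using slope_MInf[OF t(1)] t(2) that by auto
      show "right_lim (upper_log_mgf F \<mu> c) t - ereal t * z = 0"
        unfolding value_eq using that by (simp add: G_def)
      show "((\<lambda>i. legendre (upper_log_mgf F \<mu> c) (x i)) \<longlongrightarrow> 0) F"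
        using legendre_tendsto_zero x slope_MInf(3)[OF t(1)] t(2) that by auto
    qed
    assume "\<exists>s. (\<forall>n. affine_end (upper_log_mgf F \<mu> c) t < ereal (s n)) \<and>
      (\<lambda>n. ereal (s n)) \<longlonglongrightarrow> affine_end (upper_log_mgf F \<mu> c) t \<and>
      (\<forall>n. log_mgf_exists F \<mu> c (s n))"
    then obtain s where "\<And>n. affine_end (upper_log_mgf F \<mu> c) t < ereal (s n)"
      "(\<lambda>n. ereal (s n)) \<longlonglongrightarrow> affine_end (upper_log_mgf F \<mu> c) t"
      "\<And>n. log_mgf_exists F \<mu> c (s n)"
      by blast
    note tendsto = prob_tendsto_G[OF t z x y this]
    show "(scaled_log_prob \<mu> c (\<lambda>i. {x i..y i})
        \<longlongrightarrow> Limsup F (scaled_log_prob \<mu> c (\<lambda>i. {x i..y i}))) F"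
      "(scaled_log_prob \<mu> c (\<lambda>i. {x i<..<y i})
        \<longlongrightarrow> Limsup F (scaled_log_prob \<mu> c (\<lambda>i. {x i<..<y i}))) F"
      unfolding Limsup_eq by (fact tendsto)+
  next
    fix \<tau> :: "ereal \<Rightarrow> real" and g :: "ereal \<Rightarrow> ereal"
    let ?J = "{slope lam..<left_deriv (upper_log_mgf F \<mu> c) (lam + eps)}"
    assume \<tau>: "\<forall>z\<in>?J. \<tau> z \<in> {lam..<lam + eps} \<and> slope (\<tau> z) = z"
      and g: "\<forall>z. g z = right_lim (upper_log_mgf F \<mu> c) (\<tau> z) - ereal (\<tau> z) * z"
    have "\<forall>z\<in>?J. g z = G z"
      using \<tau> g right_value_eq_G by metis
    note props = transform_properties[OF this]
    show "g ` ?J \<subseteq> {-\<infinity><..0}" by (rule props(1))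
    show "strict_antimono_on ?J g" by (rule props(2))
    show "continuous_on ?J g" by (rule props(3))
    show "(\<forall>M :: real. \<exists>z\<in>?J. g z < ereal M) \<longleftrightarrow> left_deriv (upper_log_mgf F \<mu> c) (lam + eps) = \<infinity>"
      by (rule props(4))
    show "g (slope lam) = 0 \<longleftrightarrow>
        (lam > 0 \<and> ereal_differentiable_at (upper_log_mgf F \<mu> c) lam \<and> linear_fun_on {0..lam} (upper_log_mgf F \<mu> c)) \<or>
        (lam = 0 \<and> continuous (at_right 0) (upper_log_mgf F \<mu> c))"
      by (rule props(5))
    show "strict_concave_on {r. slope lam < ereal r \<and> ereal r < left_deriv (upper_log_mgf F \<mu> c) (lam + eps)}
        (\<lambda>r. real_of_ereal (g (ereal r)))"
      by (rule props(6))
    show "(\<lambda>r. real_of_ereal (g (ereal r))) differentiable (at r)"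
      if "strict_convex_on {r. affine_end (upper_log_mgf F \<mu> c) lam < ereal r \<and> r < lam + eps}
          (\<lambda>r. real_of_ereal (upper_log_mgf F \<mu> c r))"
        and "slope lam < ereal r" "ereal r < left_deriv (upper_log_mgf F \<mu> c) (lam + eps)" for r
      by (rule props(7)[OF that])
  qed
qed

end
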